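(* Let $a\ge2$ be an integer, $0<\alpha,\beta<1$, and $\tau=u+iv$ in the complex upper half-plane $\mathbb{H}$. With $\mathcal{E}^-_{2-a}$ and $F_a^{[\alpha,\beta]}$ as defined in the context, we have $$\mathcal{E}^-_{2-a}(\alpha\tau+\beta;\tau)=-\frac{(-2\pi)^{a-1}i}{(a-2)!}\int_{-\overline\tau}^{i\infty}\frac{F_a^{[\alpha,\beta]}(w)-\frac{B_a(\alpha)}{a}}{(-i(w+\tau))^{2-a}}\,dw,$$ where $F_a^{[\alpha,\beta]}$ is a modular form with characteristics, in the sense that for all $\tau\in\mathbb{H}$: (1) $F_a^{[\alpha,\beta]}(\tau+1)=F_a^{[\alpha,\beta-\alpha]}(\tau)$; (2) $F_a^{[\alpha,\beta]}\left(-\frac1\tau\right)=\tau^aF_a^{[1-\beta,\alpha]}(\tau)$; (3) $F_a^{[1-\alpha,1-\beta]}(\tau)=(-1)^aF_a^{[\alpha,\beta]}(\tau)$.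
   Context: $B_n(t)$ is the $n$-th Bernoulli polynomial and $\Gamma^*(n,w)=\frac{\Gamma(n,w)}{\Gamma(n)}=e^{-w}\sum_{k=0}^{n-1}\frac{w^k}{k!}$ for integers $n\ge1$. For $0<\alpha<1$, $\beta\in\mathbb{R}$, $\tau\in\mathbb{H}$, $$F_a^{[\alpha,\beta]}(\tau)=\frac{B_a(\alpha)}{a}-(-1)^a\sum_{m,\ell\ge1}(\ell-\alpha)^{a-1}e^{2\pi i m\beta}e^{2\pi i m(\ell-\alpha)\tau}-\sum_{\substack{m\ge1\\ \ell\ge0}}(\ell+\alpha)^{a-1}e^{-2\pi i m\beta}e^{2\pi i m(\ell+\alpha)\tau}.$$ For $z=x+iy\in\mathbb{C}$, $$\mathcal{E}^-_{2-a}(z;\tau)=\sum_{\substack{m\ge1\\ \ell\ge1+\lfloor y/v\rfloor}}\frac{\Gamma^*\left(a-1,4\pi m\left(\ell-\frac yv\right)v\right)}{m^{a-1}}e^{2\pi i m(z-\ell\tau)}+(-1)^a\sum_{\substack{m\ge1\\ \ell\ge-\lfloor y/v\rfloor}}\frac{\Gamma^*\left(a-1,4\pi m\left(\ell+\frac yv\right)v\right)}{m^{a-1}}e^{-2\pi i m(z+\ell\tau)}.$$ For $z=\alpha\tau+\beta$ one has $y/v=\alpha\in(0,1)$, so $\lfloor y/v\rfloor=0$. *)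

theory Defs
  imports "HOL-Complex_Analysis.Complex_Analysis"
begin

text \<open>
  The Bernoulli polynomials, by their generating function
  \<open>t e\<^sup>x\<^sup>t / (e\<^sup>t - 1) = \<Sum>n. B\<^sub>n(x) t\<^sup>n / n!\<close>. The denominator is not a unit, but division of formal
  power series by it is exact: numerator and denominator both have subdegree 1.
\<close>
definition bernoulli_polynomial :: "nat \<Rightarrow> real \<Rightarrow> real" where
  "bernoulli_polynomial n x = fact n * fps_nth (fps_X * fps_exp x / (fps_exp 1 - 1)) n"

definition upper_Gamma :: "nat \<Rightarrow> real \<Rightarrow> real" where
  "upper_Gamma n w = integral {w..} (\<lambda>t. t ^ (n - 1) * exp (- t))"

definition Gamma_star :: "nat \<Rightarrow> real \<Rightarrow> real" where
  "Gamma_star n w = upper_Gamma n w / Gamma (real n)"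

lemma upper_Gamma_has_integral:
  assumes "w \<ge> 0"
  shows "((\<lambda>t::real. t ^ k * exp (- t)) has_integral
          fact k * exp (- w) * (\<Sum>j\<le>k. w ^ j / fact j)) {w..}"
proof (rule has_integral_to_inf)
  let ?F = "\<lambda>t::real. - fact k * (\<Sum>j\<le>k. t ^ j * exp (- t) / fact j)"
  have deriv: "(?F has_real_derivative x ^ k * exp (- x)) (at x)" for x
  proof (induction k)
    case 0
    show ?case by (auto intro!: derivative_eq_intros)
  next
    case (Suc k)
    let ?G = "\<lambda>t::real. - fact k * (\<Sum>j\<le>k. t ^ j * exp (- t) / fact j)"
    have eq: "(\<lambda>t::real. - fact (Suc k) * (\<Sum>j\<le>Suc k. t ^ j * exp (- t) / fact j)) =
              (\<lambda>t. real (Suc k) * ?G t - t ^ Suc k * exp (- t))"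
      by (rule ext)
         (simp add: distrib_left del: fact_Suc power_Suc, simp add: algebra_simps del: power_Suc)
    show ?case
      unfolding eq
      by (rule derivative_eq_intros Suc refl)+ (simp add: algebra_simps)
  qed
  have ftc: "((\<lambda>t. t ^ k * exp (- t)) has_integral ?F y - ?F w) {w..y}" if "y \<ge> w" for y
    using that deriv
    by (intro fundamental_theorem_of_calculus)
       (auto simp: has_real_derivative_iff_has_vector_derivative[symmetric]
             intro: has_field_derivative_at_within)
  have Fw: "- ?F w = fact k * exp (- w) * (\<Sum>j\<le>k. w ^ j / fact j)"
    by (simp add: sum_distrib_left sum_negf mult_ac)
  have "((\<lambda>y::real. - fact k * (\<Sum>j\<le>k. (y ^ j / exp y) / fact j)) \<longlongrightarrow>
          - fact k * (\<Sum>j\<le>k. 0 / fact j)) at_top"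
    by (intro tendsto_intros tendsto_power_div_exp_0) simp
  hence "(?F \<longlongrightarrow> 0) at_top"
    by (simp add: exp_minus field_simps)
  hence "((\<lambda>y. ?F y - ?F w) \<longlongrightarrow> 0 - ?F w) at_top"
    by (intro tendsto_diff tendsto_const)
  moreover have "\<forall>\<^sub>F y in at_top. ?F y - ?F w = integral {w..y} (\<lambda>t. t ^ k * exp (- t))"
    using eventually_ge_at_top[of w] by eventually_elim (rule integral_unique[OF ftc, symmetric])
  ultimately show "((\<lambda>y. integral {w..y} (\<lambda>t. t ^ k * exp (- t))) \<longlongrightarrow>
      fact k * exp (- w) * (\<Sum>j\<le>k. w ^ j / fact j)) at_top"
    unfolding Fw[symmetric] using Lim_transform_eventually by force
qed (use assms in \<open>auto intro!: integrable_continuous_interval continuous_intros\<close>)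

lemma Gamma_star_eq:
  assumes "n \<ge> 1" and "w \<ge> 0"
  shows "Gamma_star n w = exp (- w) * (\<Sum>k<n. w ^ k / fact k)"
proof -
  obtain k where n: "n = Suc k" using assms(1) by (cases n) auto
  have "Gamma (real n) = fact k"
    by (simp add: n Gamma_fact add.commute)
  thus ?thesis
    using integral_unique[OF upper_Gamma_has_integral[OF assms(2), of k]]
    by (simp add: Gamma_star_def upper_Gamma_def n lessThan_Suc_atMost)
qed

text \<open>
  Double series are unordered sums over pairs of indices; in each pair the first component
  is \<open>m\<close> and the second is \<open>\<ell>\<close>.
\<close>

definition F_char :: "nat \<Rightarrow> real \<Rightarrow> real \<Rightarrow> complex \<Rightarrow> complex" where
  "F_char a \<alpha> \<beta> \<tau> =
     of_real (bernoulli_polynomial a \<alpha> / real a)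
     - (-1) ^ a * (\<Sum>\<^sub>\<infinity>(m, l)\<in>{1::nat..} \<times> {1::nat..}.
          of_real ((real l - \<alpha>) ^ (a - 1)) * exp (2 * pi * \<i> * of_nat m * of_real \<beta>)
            * exp (2 * pi * \<i> * of_nat m * of_real (real l - \<alpha>) * \<tau>))
     - (\<Sum>\<^sub>\<infinity>(m, l)\<in>{1::nat..} \<times> {0::nat..}.
          of_real ((real l + \<alpha>) ^ (a - 1)) * exp (- 2 * pi * \<i> * of_nat m * of_real \<beta>)
            * exp (2 * pi * \<i> * of_nat m * of_real (real l + \<alpha>) * \<tau>))"

text \<open>
  The function \<open>\<E>\<^sup>-\<close> of weight \<open>2 - a\<close>; the argument \<open>a\<close> is the one in the weight \<open>2 - a\<close>,
  not the weight itself.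
\<close>
definition E_minus :: "nat \<Rightarrow> complex \<Rightarrow> complex \<Rightarrow> complex" where
  "E_minus a z \<tau> = (let y = Im z; v = Im \<tau> in
     (\<Sum>\<^sub>\<infinity>(m, l)\<in>{1::nat..} \<times> {1 + \<lfloor>y / v\<rfloor>..}.
        of_real (Gamma_star (a - 1) (4 * pi * real m * (real_of_int l - y / v) * v)
                   / real m ^ (a - 1))
          * exp (2 * pi * \<i> * of_nat m * (z - of_int l * \<tau>)))
     + (-1) ^ a * (\<Sum>\<^sub>\<infinity>(m, l)\<in>{1::nat..} \<times> {- \<lfloor>y / v\<rfloor>..}.
        of_real (Gamma_star (a - 1) (4 * pi * real m * (real_of_int l + y / v) * v)
                   / real m ^ (a - 1))
          * exp (- 2 * pi * \<i> * of_nat m * (z + of_int l * \<tau>))))"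

text \<open>
  Integrals from \<open>z\<^sub>0\<close> to \<open>i\<infinity>\<close> are taken along the vertical ray \<open>w = z\<^sub>0 + i t\<close>, \<open>t \<ge> 0\<close>,
  so \<open>dw = i dt\<close>.
\<close>
definition integrable_to_i_infinity :: "(complex \<Rightarrow> complex) \<Rightarrow> complex \<Rightarrow> bool" where
  "integrable_to_i_infinity f z0 \<longleftrightarrow> (\<lambda>t::real. f (z0 + \<i> * of_real t) * \<i>) integrable_on {0..}"

definition integral_to_i_infinity :: "(complex \<Rightarrow> complex) \<Rightarrow> complex \<Rightarrow> complex" where
  "integral_to_i_infinity f z0 = integral {0..} (\<lambda>t::real. f (z0 + \<i> * of_real t) * \<i>)"

end

theory Submission
  imports Defs
begin

text \<open>
  Lipschitz summation with a character, together with the Fourier series of the Bernoulli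
  polynomials for the terms with \<open>m = 0\<close>, turns \<open>F\<close> into the lattice sum
  \<open>F(\<tau>) = - (a - 1)! / (-2\<pi>i)\<^sup>a \<Sum>\<^sub>m \<Sum>\<^sub>n e(-m\<beta> - n\<alpha>) / (m\<tau> + n)\<^sup>a\<close> with \<open>e(x) = exp (2\<pi>ix)\<close>.
  Replacing \<open>\<tau>\<close> by \<open>-1/\<tau>\<close> exchanges the roles of \<open>m\<close> and \<open>n\<close>, so inversion amounts to
  exchanging the order of summation. For \<open>a = 2\<close> the double series is only conditionally
  convergent, but multiplication by \<open>1 - e(-\<alpha>) \<noteq> 0\<close> (summation by parts in \<open>n\<close>) makes
  it absolutely convergent. Both Fourier expansions follow from the recurrence
  \<open>A\<^sub>n' = n A\<^sub>n\<^sub>-\<^sub>1 + 2\<pi>iz A\<^sub>n\<close>, which yields the coefficients \<open>n! / (-2\<pi>i(z + k))\<^sup>n\<^sup>+\<^sup>1\<close>;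
  the Bernoulli polynomials are the degenerate case \<open>z = 0\<close>. The integral formula is termwise
  integration along the vertical ray, where \<open>-i(w + \<tau>) = 2v + t\<close>.
\<close>

subsection \<open>Fourier series\<close>

text \<open>A continuous function with equal endpoint values and absolutely summable Fourier
  coefficients is the sum of its Fourier series, so no finer pointwise convergence theory is
  involved. This is one place where \<open>a \<ge> 2\<close> matters: A_0 jumps by 1 between the
  endpoints, whereas from index 1 on the functions are periodic with coefficients of size O(k^-2).

  In weight 2 a lattice sum without character really changes when the order of summation is
  exchanged (quasi-modularity of the Eisenstein series of weight 2). A character e(-n\<alpha>) with
  non-integral \<alpha> prevents this: a unit shift in n multiplies it by a constant q \<noteq> 1,
  so that 1 - q times the sum is a sum of differences of size |m\<tau> + n|^(-a-1), which is
  absolutely summable over a plane lattice for every \<open>a \<ge> 2\<close>.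

  Only the inversion needs the lattice sum. Translation is termwise in the double series over (m,
  l), and so is the reflection apart from its Bernoulli constant.\<close>

definition qexp :: "complex \<Rightarrow> complex" where
  "qexp x = exp (2 * of_real pi * \<i> * x)"

lemma qexp_0 [simp]: "qexp 0 = 1"
  by (simp add: qexp_def)

lemma qexp_add: "qexp (x + y) = qexp x * qexp y"
  by (simp add: qexp_def exp_add distrib_left)

lemma qexp_minus: "qexp (- x) = inverse (qexp x)"
  by (simp add: qexp_def exp_minus)

lemma qexp_of_int [simp]: "qexp (of_int k) = 1"
  unfolding qexp_def exp_eq_1 by (auto intro!: exI[of _ k])

lemma qexp_of_nat [simp]: "qexp (of_nat k) = 1"
  using qexp_of_int[of "int k"] by simp

lemma qexp_1 [simp]: "qexp 1 = 1"
  using qexp_of_int[of 1] by simp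

lemma norm_qexp: "norm (qexp x) = exp (- 2 * pi * Im x)"
  by (simp add: qexp_def norm_exp_eq_Re)

lemma norm_qexp_of_real [simp]: "norm (qexp (of_real x)) = 1"
  by (simp add: norm_qexp)

lemma norm_qexp_of_int_of_real [simp]: "norm (qexp (of_int k * of_real x)) = 1"
  by (simp add: norm_qexp)

lemma norm_qexp_minus_of_int_of_real [simp]: "norm (qexp (- (of_int k * of_real x))) = 1"
  by (simp add: norm_qexp)

lemma qexp_nonzero [simp]: "qexp x \<noteq> 0"
  by (simp add: qexp_def)

lemma continuous_on_qexp [continuous_intros]:
  "continuous_on A f \<Longrightarrow> continuous_on A (\<lambda>x. qexp (f x))"
  unfolding qexp_def by (intro continuous_intros)

lemma qexp_eq_1_iff: "qexp (of_real x) = 1 \<longleftrightarrow> x \<in> \<int>"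
proof
  assume "qexp (of_real x) = 1"
  then obtain n :: int where "2 * pi * x = of_int (2 * n) * pi"
    by (auto simp: qexp_def exp_eq_1)
  hence "x = of_int n" by simp
  thus "x \<in> \<int>" by simp
qed (auto elim!: Ints_cases)

text \<open>
  By Stone--Weierstrass on the unit circle, where polynomials in \<open>Re\<close> and \<open>Im\<close> are
  trigonometric polynomials. The class of functions \<open>d\<close> with vanishing Fourier coefficients is
  stable under multiplication with those.
\<close>
lemma fourier_uniqueness:
  fixes d :: "real \<Rightarrow> complex"
  assumes cont: "continuous_on {0..1} d" and per: "d 0 = d 1"
    and coeff: "\<And>k::int. ((\<lambda>x. d x * qexp (of_int k * of_real x)) has_integral 0) {0..1}"
    and x: "x \<in> {0..1}"
  shows "d x = 0"
proof -
  define V where "V = {D :: real \<Rightarrow> complex. continuous_on {0..1} D \<and>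
     (\<forall>k::int. ((\<lambda>x. D x * qexp (of_int k * of_real x)) has_integral 0) {0..1})}"
  have V_add: "(\<lambda>x. f x + g x) \<in> V" if "f \<in> V" "g \<in> V" for f g
  proof -
    have "((\<lambda>x. (f x + g x) * qexp (of_int k * of_real x)) has_integral 0 + 0) {0..1}" for k :: int
      unfolding distrib_right using that by (intro has_integral_add) (auto simp: V_def)
    thus ?thesis using that by (auto simp: V_def intro!: continuous_intros)
  qed
  have V_cmult: "(\<lambda>x. f x * c) \<in> V" if "f \<in> V" for f c
  proof -
    have "((\<lambda>x. f x * c * qexp (of_int k * of_real x)) has_integral 0) {0..1}" for k :: int
    proof -
      have "((\<lambda>x. f x * qexp (of_int k * of_real x)) has_integral 0) {0..1}"
        using that by (auto simp: V_def)
      from has_integral_mult_left[OF this, of c] show ?thesis by (simp add: mult_ac)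
    qed
    thus ?thesis using that by (auto simp: V_def intro!: continuous_intros)
  qed
  have V_shift: "(\<lambda>x. f x * qexp (of_int j * of_real x)) \<in> V" if "f \<in> V" for f and j :: int
  proof -
    have "((\<lambda>x. f x * qexp (of_int j * of_real x) * qexp (of_int k * of_real x)) has_integral 0) {0..1}" for k :: int
    proof -
      have "((\<lambda>x. f x * qexp (of_int (j + k) * of_real x)) has_integral 0) {0..1}"
        using that unfolding V_def by blast
      thus ?thesis by (simp only: of_int_add distrib_right qexp_add mult.assoc)
    qed
    thus ?thesis using that by (auto simp: V_def intro!: continuous_intros)
  qed
  define E where "E = (\<lambda>x::real. qexp (of_real x))"
  have V_poly: "(\<lambda>x. f x * of_real (p (E x))) \<in> V"
    if "real_polynomial_function p" "f \<in> V" for f p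
    using that
  proof (induction p arbitrary: f rule: real_polynomial_function.induct)
    case (linear h f)
    \<comment> \<open>A real-linear functional on the plane is a combination of Re and Im, and on
      the unit circle these are combinations of \<open>E x\<close> and its inverse. Hence shifts by
      +1 and -1 suffice.\<close>
    have h: "h z = Re z * h 1 + Im z * h \<i>" for z
    proof -
      interpret bounded_linear h by fact
      have "h z = h (Re z *\<^sub>R 1 + Im z *\<^sub>R \<i>)"
        by (metis complex_eq mult.commute scaleR_conv_of_real mult.right_neutral)
      thus ?thesis by (simp add: add scaleR)
    qed
    have E: "of_real (Re (E x)) = (E x + inverse (E x)) / 2"
            "of_real (Im (E x)) = (E x - inverse (E x)) / (2 * \<i>)" for x
    proof -
      have "inverse (E x) = cnj (E x)"
        by (metis E_def inverse_eq_divide divide_conv_cnj mult_1 norm_qexp_of_real)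
      thus "of_real (Re (E x)) = (E x + inverse (E x)) / 2"
            "of_real (Im (E x)) = (E x - inverse (E x)) / (2 * \<i>)"
        by (simp_all add: complex_eq_iff)
    qed
    define c1 where "c1 = of_real (h 1) / 2 + of_real (h \<i>) / (2 * \<i>)"
    define c2 where "c2 = of_real (h 1) / 2 - of_real (h \<i>) / (2 * \<i>)"
    have "(\<lambda>x. f x * of_real (h (E x))) =
       (\<lambda>x. f x * qexp (of_int 1 * of_real x) * c1 + f x * qexp (of_int (-1) * of_real x) * c2)"
      by (subst h) (simp add: E fun_eq_iff c1_def c2_def, simp add: E_def qexp_minus field_simps)
    also have "\<dots> \<in> V"
      by (intro V_add V_cmult V_shift linear)
    finally show ?case .
  next
    case (const c f)
    thus ?case by (rule V_cmult)
  next
    case (add p1 p2 f)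
    thus ?case using V_add[OF add.IH(1)[of f] add.IH(2)[of f]] by (simp add: distrib_left)
  next
    case (mult p1 p2 f)
    thus ?case using mult.IH(2)[OF mult.IH(1)[of f]] by (simp add: mult_ac)
  qed
  have d: "d \<in> V"
    using cont coeff by (auto simp: V_def)

  define D where "D = (\<lambda>z. cnj (d (Arg2pi z / (2 * pi))))"
  \<comment> \<open>\<open>Arg2pi\<close> jumps at the positive real axis, so continuity of the
    composition is not immediate. The trivial homotopy from d to itself serves only to obtain that
    the loop d descends continuously to the circle.\<close>
  have "homotopic_loops UNIV d d"
    using cont per by (simp add: homotopic_loops_refl path_def pathstart_def pathfinish_def)
  from homotopic_loops_imp_homotopic_circlemaps[OF this]
  have "continuous_on (sphere 0 1) (d \<circ> (\<lambda>z. (Arg2pi z / (2 * pi))))"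
    by (rule homotopic_with_imp_continuous[THEN conjunct1])
  hence contD: "continuous_on (sphere 0 1) D"
    unfolding D_def o_def by (intro continuous_intros)
  have DE: "D (E x) = cnj (d x)" if "x \<in> {0..1}" for x
  proof (cases "x = 1")
    case True
    thus ?thesis using per by (simp add: D_def E_def Arg2pi_of_real[of 1, simplified])
  next
    case False
    hence "Arg2pi (E x) = 2 * pi * x"
      using that unfolding E_def qexp_def by (subst Arg2pi_exp) auto
    thus ?thesis by (simp add: D_def)
  qed
  have int0: "integral {0..1} (\<lambda>x. d x * g (E x)) = 0" and contg: "continuous_on {0..1} (\<lambda>x. d x * g (E x))"
    if "polynomial_function g" for g :: "complex \<Rightarrow> complex"
  proof -
    have "real_polynomial_function (Re \<circ> g)" "real_polynomial_function (Im \<circ> g)"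
      using that by (auto simp: polynomial_function_def bounded_linear_Re bounded_linear_Im)
    from this[THEN V_poly, OF d]
    have "(\<lambda>x. d x * of_real (Re (g (E x))) + d x * of_real (Im (g (E x))) * \<i>) \<in> V"
      by (intro V_add V_cmult) (auto simp: o_def)
    also have "(\<lambda>x. d x * of_real (Re (g (E x))) + d x * of_real (Im (g (E x))) * \<i>) = 
               (\<lambda>x. d x * g (E x))"
    proof
      fix x
      have "d x * g (E x) = d x * (of_real (Re (g (E x))) + \<i> * of_real (Im (g (E x))))"
        by (subst complex_eq[of "g (E x)"]) simp
      thus "d x * of_real (Re (g (E x))) + d x * of_real (Im (g (E x))) * \<i> = d x * g (E x)"
        by (simp add: algebra_simps)
    qed
    finally have *: "(\<lambda>x. d x * g (E x)) \<in> V" .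
    from * have "((\<lambda>x. d x * g (E x) * qexp (of_int 0 * of_real x)) has_integral 0) {0..1}"
      unfolding V_def by blast
    thus "integral {0..1} (\<lambda>x. d x * g (E x)) = 0" by (simp add: integral_unique)
    show "continuous_on {0..1} (\<lambda>x. d x * g (E x))" using * by (auto simp: V_def)
  qed

  have "bounded (d ` {0..1})"
    by (intro compact_imp_bounded compact_continuous_image cont) auto
  then obtain M where "\<forall>x\<in>{0..1}. norm (d x) \<le> M"
    unfolding bounded_iff by blast
  hence M: "norm (d x) \<le> M" if "x \<in> {0..1}" for x
    using that by blast
  have M0: "M \<ge> 0" using M[OF x] norm_ge_zero[of "d x"] by linarith
  have cont2: "continuous_on {0..1} (\<lambda>x. d x * cnj (d x))"
    using cont by (intro continuous_intros)
  have "norm (integral {0..1} (\<lambda>x. d x * cnj (d x))) \<le> 0 + e" if "e > 0" for e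
  proof -
    \<comment> \<open>As d is orthogonal to g(E x), the integral of |d|^2 equals that of d (cnj d -
      g(E x)), which is at most M e / (M + 1). The added 1 covers M = 0.\<close>
    have "e / (M + 1) > 0" using M0 that by simp
    from Stone_Weierstrass_polynomial_function[OF compact_sphere contD this]
    obtain g :: "complex \<Rightarrow> complex" where g: "polynomial_function g \<and>
       (\<forall>z \<in> sphere 0 1. norm (D z - g z) < e / (M + 1))" ..
    have "integral {0..1} (\<lambda>x. d x * cnj (d x)) = 
          integral {0..1} (\<lambda>x. d x * cnj (d x)) - integral {0..1} (\<lambda>x. d x * g (E x))"
      using int0[OF conjunct1[OF g]] by simp
    also have "\<dots> = integral {0..1} (\<lambda>x. d x * cnj (d x) - d x * g (E x))"
      by (rule integral_diff [symmetric])
         (intro integrable_continuous_interval cont2 contg conjunct1[OF g])+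
    also have "norm \<dots> \<le> e * (1 - 0)"
    proof (rule integral_bound)
      show "continuous_on {0..1} (\<lambda>x. d x * cnj (d x) - d x * g (E x))"
        by (intro continuous_on_diff cont2 contg conjunct1[OF g])
      fix t :: real assume t: "t \<in> {0..1}"
      have "norm (d t * cnj (d t) - d t * g (E t)) = norm (d t) * norm (D (E t) - g (E t))"
        by (simp add: DE[OF t] right_diff_distrib flip: norm_mult)
      also have "\<dots> \<le> M * (e / (M + 1))"
        by (intro mult_mono M t less_imp_le[OF bspec[OF conjunct2[OF g]]] M0) (auto simp: E_def)
      also have "\<dots> \<le> e" using M0 that by (simp add: field_simps)
      finally show "norm (d t * cnj (d t) - d t * g (E t)) \<le> e" .
    qed auto
    finally show ?thesis by simp
  qed
  hence "norm (integral {0..1} (\<lambda>x. d x * cnj (d x))) \<le> 0"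
    by (rule field_le_epsilon)
  hence "((\<lambda>x. d x * cnj (d x)) has_integral 0) {0..1}"
    using integrable_integral[OF integrable_continuous_interval[OF cont2]] by simp
  from has_integral_linear[OF this bounded_linear_Re]
  have "((\<lambda>x. (norm (d x))\<^sup>2) has_integral 0) {0..1}"
    by (simp add: o_def flip: cmod_power2 power2_eq_square)
  hence "(norm (d x))\<^sup>2 = 0"
    using x cont
    by (intro has_integral_0_cbox_imp_0[of 0 1 "\<lambda>x. (norm (d x))\<^sup>2"]) (auto intro!: continuous_intros)
  thus ?thesis by simp
qed

text \<open>Absolute summability makes the series converge uniformly, so its sum g is continuous and
  has the same coefficients as f; uniqueness then applies to f - g. Coefficients are taken against
  e(kx), hence the series runs over e(-kx).\<close>

lemma fourier_inversion:
  fixes f :: "real \<Rightarrow> complex" and c :: "int \<Rightarrow> complex"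
  assumes cont: "continuous_on {0..1} f" and per: "f 0 = f 1"
    and coeff: "\<And>k. ((\<lambda>x. f x * qexp (of_int k * of_real x)) has_integral c k) {0..1}"
    and summ: "(\<lambda>k. norm (c k)) summable_on UNIV"
    and x: "x \<in> {0..1}"
  shows "((\<lambda>k. c k * qexp (- (of_int k * of_real x))) has_sum f x) UNIV"
proof -
  define g where "g = (\<lambda>x::real. \<Sum>\<^sub>\<infinity>k. c k * qexp (- (of_int k * of_real x)))"
  have hs: "((\<lambda>k. c k * qexp (- (of_int k * of_real x))) has_sum g x) UNIV" for x :: real
  proof -
    have "(\<lambda>k. norm (c k * qexp (- (of_int k * of_real x)))) summable_on UNIV"
      using summ by (simp add: norm_mult)
    thus ?thesis unfolding g_def by (rule has_sum_infsum[OF abs_summable_summable])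
  qed
  have unif: "uniform_limit {0..1} (\<lambda>X x. \<Sum>k\<in>X. c k * qexp (- (of_int k * of_real x))) g
                (finite_subsets_at_top UNIV)"
    by (rule Weierstrass_m_test_general'[OF _ hs summ]) (simp add: norm_mult)
  have contg: "continuous_on {0..1} g"
    by (rule uniform_limit_theorem[OF always_eventually unif])
       (intro allI continuous_intros, simp)
  have intg: "((\<lambda>x. g x * qexp (of_int j * of_real x)) has_integral c j) {0..1}" for j
  proof -
    have "bounded (g ` {0..1})" 
      by (intro compact_imp_bounded compact_continuous_image contg) auto
    moreover have "bounded ((\<lambda>x. qexp (of_int j * of_real x)) ` {0..1::real})"
      by (intro compact_imp_bounded compact_continuous_image continuous_intros) auto
    ultimately have unif2: "uniform_limit {0..1} 
        (\<lambda>X x. (\<Sum>k\<in>X. c k * qexp (- (of_int k * of_real x))) * qexp (of_int j * of_real x))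
        (\<lambda>x. g x * qexp (of_int j * of_real x)) (finite_subsets_at_top UNIV)"
      by (rule uniform_lim_mult[OF unif uniform_limit_const])
    have contX: "continuous_on {0..1} (\<lambda>x. (\<Sum>k\<in>X. c k * qexp (- (of_int k * of_real x))) * qexp (of_int j * of_real x))" for X
      by (intro continuous_intros)
    obtain I J where I: "\<And>X. ((\<lambda>x. (\<Sum>k\<in>X. c k * qexp (- (of_int k * of_real x))) * qexp (of_int j * of_real x)) has_integral I X) {0..1::real}"
      and J: "((\<lambda>x. g x * qexp (of_int j * of_real x)) has_integral J) {0..1}"
      and IJ: "(I \<longlongrightarrow> J) (finite_subsets_at_top UNIV)"
      using uniform_limit_integral[OF unif2 contX finite_subsets_at_top_neq_bot] by blast
    have orth: "((\<lambda>x. qexp (of_int k * of_real x)) has_integral (if k = 0 then 1 else 0)) {0..1::real}" for k :: int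
    proof (cases "k = 0")
      case False
      have "((\<lambda>x. qexp (of_int k * of_real x)) has_integral 
             (qexp (of_int k * of_real 1) / (2 * pi * \<i> * of_int k) - qexp (of_int k * of_real 0) / (2 * pi * \<i> * of_int k))) {0..1::real}"
        unfolding qexp_def using False
        by (intro fundamental_theorem_of_calculus has_vector_derivative_real_field)
           (auto intro!: derivative_eq_intros)
      thus ?thesis using False by simp
    qed (use has_integral_const_real[of "1::complex" 0 1] in auto)
    have "I X = (if j \<in> X then c j else 0)" if "finite X" for X
    proof -
      have "((\<lambda>x. \<Sum>k\<in>X. c k * qexp (of_int (j - k) * of_real x)) has_integral 
              (\<Sum>k\<in>X. c k * (if j - k = 0 then 1 else 0))) {0..1::real}"
        using that by (intro has_integral_sum has_integral_mult_right orth) auto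
      also have "(\<lambda>x. \<Sum>k\<in>X. c k * qexp (of_int (j - k) * of_real x)) = 
        (\<lambda>x::real. (\<Sum>k\<in>X. c k * qexp (- (of_int k * of_real x))) * qexp (of_int j * of_real x))"
        by (simp add: sum_distrib_right fun_eq_iff left_diff_distrib mult.assoc flip: qexp_add)
      finally have "((\<lambda>x::real. (\<Sum>k\<in>X. c k * qexp (- (of_int k * of_real x))) * qexp (of_int j * of_real x))
          has_integral (\<Sum>k\<in>X. c k * (if j - k = 0 then 1 else 0))) {0..1}" .
      with I[of X] have "I X = (\<Sum>k\<in>X. c k * (if j - k = 0 then 1 else 0))"
        by (rule has_integral_unique)
      also have "\<dots> = (\<Sum>k\<in>X. if k = j then c j else 0)"
        by (intro sum.cong) auto
      finally show ?thesis using that by simp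
    qed
    \<comment> \<open>By orthogonality the integral depends only on whether j lies in X, so the net
      is constant from {j} on.\<close>
    hence "eventually (\<lambda>X. I X = c j) (finite_subsets_at_top UNIV)"
      unfolding eventually_finite_subsets_at_top by (intro exI[of _ "{j}"]) auto
    hence "(I \<longlongrightarrow> c j) (finite_subsets_at_top UNIV)"
      by (rule tendsto_eventually)
    with IJ have "J = c j" by (intro tendsto_unique[OF _ IJ]) auto
    thus ?thesis using J by simp
  qed
  have "f x - g x = 0"
  proof (rule fourier_uniqueness[of "\<lambda>x. f x - g x", OF _ _ _ x])
    show "continuous_on {0..1} (\<lambda>x. f x - g x)" by (intro continuous_intros cont contg)
    have "g 0 = g 1" by (simp add: g_def qexp_minus)
    thus "f 0 - g 0 = f 1 - g 1" using per by simp
    show "((\<lambda>x. (f x - g x) * qexp (of_int k * of_real x)) has_integral 0) {0..1}" for k :: int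
      using has_integral_diff[OF coeff intg, of k k] by (simp add: left_diff_distrib)
  qed
  with hs[of x] show ?thesis by simp
qed

subsection \<open>Appell sequences and Bernoulli polynomials\<close>

text \<open>Integration by parts: the derivative of f(x) e(kx) is h(x) e(kx) + 2\<pi>i(z + k) f(x)
  e(kx), and e(k) = 1 leaves f(1) - f(0) as the boundary term.\<close>

lemma fourier_coeff_derivative:
  fixes f h :: "real \<Rightarrow> complex" and z :: complex and k :: int
  assumes deriv: "\<And>x. (f has_vector_derivative h x + 2 * of_real pi * \<i> * z * f x) (at x)"
    and h: "((\<lambda>x. h x * qexp (of_int k * of_real x)) has_integral H) {0..1}"
    and zk: "z + of_int k \<noteq> 0"
  shows "((\<lambda>x. f x * qexp (of_int k * of_real x)) has_integral
            ((f 1 - f 0 - H) / (2 * of_real pi * \<i> * (z + of_int k)))) {0..1}"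
proof -
  define w where "w = 2 * of_real pi * \<i> * (z + of_int k)"
  have w: "w \<noteq> 0" using zk by (simp add: w_def)
  have dq: "((\<lambda>x::real. qexp (of_int k * of_real x)) has_vector_derivative
              2 * of_real pi * \<i> * of_int k * qexp (of_int k * of_real x)) (at x)" for x
    unfolding qexp_def
    by (rule has_vector_derivative_real_field) (auto intro!: derivative_eq_intros)
  have "((\<lambda>x. f x * (2 * of_real pi * \<i> * of_int k * qexp (of_int k * of_real x)) +
               (h x + 2 * of_real pi * \<i> * z * f x) * qexp (of_int k * of_real x)) has_integral
         f 1 * qexp (of_int k * of_real 1) - f 0 * qexp (of_int k * of_real 0)) {0..1}"
    by (intro fundamental_theorem_of_calculus
          has_vector_derivative_at_within[OF has_vector_derivative_mult[OF deriv dq]]) simp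
  also have "(\<lambda>x. f x * (2 * of_real pi * \<i> * of_int k * qexp (of_int k * of_real x)) +
               (h x + 2 * of_real pi * \<i> * z * f x) * qexp (of_int k * of_real x)) =
      (\<lambda>x. h x * qexp (of_int k * of_real x) + w * (f x * qexp (of_int k * of_real x)))"
    unfolding w_def by (rule ext) (simp add: algebra_simps)
  finally have "((\<lambda>x. h x * qexp (of_int k * of_real x) + w * (f x * qexp (of_int k * of_real x)))
           has_integral f 1 - f 0) {0..1}"
    by simp
  from has_integral_diff[OF this h]
  have "((\<lambda>x. w * (f x * qexp (of_int k * of_real x))) has_integral (f 1 - f 0 - H)) {0..1}"
    by simp
  from has_integral_mult_right[OF this, of "inverse w"] show ?thesis
    using w unfolding w_def [symmetric] mult.assoc [symmetric]
    by (simp add: divide_inverse mult.commute)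
qed

text \<open>At n = 0 the boundary jump -1 alone survives and gives 1/(-2\<pi>i(z + k)); each later
  step has no jump and multiplies by (n + 1)/(-2\<pi>i(z + k)). The constant \<kappa> stands in for
  the missing predecessor of A_0: it is 0 for the Lerch series and -1 for Bernoulli polynomials,
  where z = 0 and A_0 is affine.\<close>

lemma fourier_coeff_appell:
  fixes A :: "nat \<Rightarrow> real \<Rightarrow> complex" and z \<kappa> :: complex and k :: int
  assumes deriv_0: "\<And>x. (A 0 has_vector_derivative \<kappa> + 2 * of_real pi * \<i> * z * A 0 x) (at x)"
    and deriv_Suc: "\<And>n x. (A (Suc n) has_vector_derivative
            of_nat (Suc n) * A n x + 2 * of_real pi * \<i> * z * A (Suc n) x) (at x)"
    and bd: "A 0 1 = A 0 0 - 1" "\<And>n. A (Suc n) 1 = A (Suc n) 0"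
    and k: "\<kappa> = 0 \<or> k \<noteq> 0" "z + of_int k \<noteq> 0"
  shows "((\<lambda>x. A n x * qexp (of_int k * of_real x)) has_integral
            (fact n / (- 2 * of_real pi * \<i> * (z + of_int k)) ^ Suc n)) {0..1}"
proof (induction n)
  case 0
  \<comment> \<open>For k \<noteq> 0 the same integration by parts, applied to the constant function
    1 with z = 0, shows that e(kx) has integral 0.\<close>
  have "((\<lambda>x. \<kappa> * qexp (of_int k * of_real x)) has_integral 0) {0..1}"
  proof (cases "\<kappa> = 0")
    case False
    hence "((\<lambda>x::real. \<kappa> * qexp (of_int k * of_real x)) has_integral 
            \<kappa> * ((1 - 1 - 0) / (2 * of_real pi * \<i> * (0 + of_int k)))) {0..1}"
      using fourier_coeff_derivative[of "\<lambda>_. 1" "\<lambda>_. 0" 0 k 0] k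
      by (intro has_integral_mult_right) auto
    thus ?thesis by simp
  qed auto
  from fourier_coeff_derivative[OF deriv_0 this k(2)] show ?case
    by (simp add: bd divide_minus_left)
next
  case (Suc n)
  have "((\<lambda>x. of_nat (Suc n) * A n x * qexp (of_int k * of_real x)) has_integral
          of_nat (Suc n) * (fact n / (- 2 * of_real pi * \<i> * (z + of_int k)) ^ Suc n)) {0..1}"
    using has_integral_mult_right[OF Suc, of "of_nat (Suc n)"] by (simp only: mult.assoc)
  note fourier_coeff_derivative[OF deriv_Suc this k(2)]
  also have "(A (Suc n) 1 - A (Suc n) 0 - of_nat (Suc n) * (fact n / (- 2 * of_real pi * \<i> * (z + of_int k)) ^ Suc n)) /
       (2 * of_real pi * \<i> * (z + of_int k)) = 
       of_nat (Suc n) * (fact n / (- 2 * of_real pi * \<i> * (z + of_int k)) ^ Suc n) / (- (2 * of_real pi * \<i> * (z + of_int k)))"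
    by (simp add: bd)
  also have "\<dots> = fact (Suc n) / (- 2 * of_real pi * \<i> * (z + of_int k)) ^ Suc (Suc n)"
    by (simp add: mult_ac)
  finally show ?case .
qed

text \<open>The Appell polynomials with exponential generating function exp(xt) times the sum of P_j
  t^j / j!. Both the Bernoulli polynomials (P the Bernoulli numbers) and the Lerch series up to an
  exponential factor (P its values at x = 0) have this form, so one differentiation rule serves
  both.\<close>

definition appell :: "(nat \<Rightarrow> 'a::comm_semiring_1) \<Rightarrow> nat \<Rightarrow> 'a \<Rightarrow> 'a" where
  "appell P n x = (\<Sum>j\<le>n. of_nat (n choose j) * P j * x ^ (n - j))"

lemma appell_0 [simp]: "appell P 0 x = P 0"
  by (simp add: appell_def)

lemma appell_Suc_deriv:
  fixes P :: "nat \<Rightarrow> 'a::real_normed_field"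
  shows "(appell P (Suc n) has_field_derivative of_nat (Suc n) * appell P n x) (at x)"
proof -
  have "((\<lambda>x. (\<Sum>j\<le>n. of_nat (Suc n choose j) * P j * x ^ (Suc n - j)) + P (Suc n)) has_field_derivative
          (\<Sum>j\<le>n. of_nat (Suc n choose j) * P j * (of_nat (Suc n - j) * x ^ (n - j)))) (at x)"
    by (rule derivative_eq_intros refl)+ (simp add: Suc_diff_le mult_ac)
  also have "(\<Sum>j\<le>n. of_nat (Suc n choose j) * P j * (of_nat (Suc n - j) * x ^ (n - j))) =
             of_nat (Suc n) * appell P n x"
    unfolding appell_def sum_distrib_left
  proof (intro sum.cong refl)
    fix j assume "j \<in> {..n}"
    have "(Suc n - j) * (Suc n choose j) = Suc n * (n choose j)"
      using binomial_absorb_comp[of "Suc n" j] by simp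
    hence eq: "of_nat (Suc n - j) * of_nat (Suc n choose j) = (of_nat (Suc n) * of_nat (n choose j) :: 'a)"
      by (simp only: of_nat_mult [symmetric])
    have "of_nat (Suc n choose j) * P j * (of_nat (Suc n - j) * x ^ (n - j)) =
          (of_nat (Suc n - j) * of_nat (Suc n choose j)) * (P j * x ^ (n - j))"
      by (simp only: mult_ac)
    thus "of_nat (Suc n choose j) * P j * (of_nat (Suc n - j) * x ^ (n - j)) =
          of_nat (Suc n) * (of_nat (n choose j) * P j * x ^ (n - j))"
      unfolding eq by (simp only: mult_ac)
  qed
  finally show ?thesis by (simp add: appell_def [abs_def])
qed

lemma continuous_on_appell [continuous_intros]:
  fixes f :: "_ \<Rightarrow> 'a::real_normed_field"
  shows "continuous_on S f \<Longrightarrow> continuous_on S (\<lambda>x. appell P n (f x))"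
  unfolding appell_def by (intro continuous_intros)

text \<open>Write exp(t) - 1 = t U with U(0) = 1; the factor t cancels exactly and the generating
  function is exp(xt) / U, so P_j / j! are the coefficients of 1/U. The difference between x = 1 and
  x = 0 is (exp(t) - 1) / U = t, which has a single nonzero coefficient.\<close>

lemma bernoulli_polynomial_appell:
  obtains P where "P 0 = 1" "\<And>n x. bernoulli_polynomial n x = appell P n x"
    "\<And>n. bernoulli_polynomial n 1 - bernoulli_polynomial n 0 = (if n = 1 then 1 else 0)"
proof -
  define D where "D = (fps_exp 1 - 1 :: real fps)"
  define U where "U = fps_shift 1 D"
  have U0: "U $ 0 = 1" by (simp add: U_def D_def)
  have D: "D = fps_X * U"
    by (simp add: fps_eq_iff U_def D_def)
  have gf: "fps_X * fps_exp x / D = fps_exp x * inverse U" for x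
    unfolding D by (subst div_mult_mult1) (simp_all add: fps_divide_unit U0)
  have diff: "bernoulli_polynomial n 1 - bernoulli_polynomial n 0 = (if n = 1 then 1 else 0)" for n
  proof -
    have "fps_exp 1 * inverse U - fps_exp 0 * inverse U = D * inverse U"
      by (simp add: D_def left_diff_distrib)
    also have "\<dots> = fps_X * (inverse U * U)"
      by (simp only: D mult_ac)
    also have "\<dots> = fps_X" by (subst inverse_mult_eq_1) (simp_all add: U0)
    finally have "(fps_exp 1 * inverse U) $ n - (fps_exp 0 * inverse U) $ n = fps_X $ n"
      by (simp only: fps_sub_nth [symmetric])
    hence "bernoulli_polynomial n 1 - bernoulli_polynomial n 0 = fact n * (fps_X :: real fps) $ n"
      unfolding bernoulli_polynomial_def D_def [symmetric] gf right_diff_distrib [symmetric] by (rule arg_cong)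
    thus ?thesis by (simp add: fps_X_def)
  qed
  define P where "P = (\<lambda>j. fact j * (inverse U) $ j)"
  have eq: "bernoulli_polynomial n x = appell P n x" for n x
  proof -
    have "bernoulli_polynomial n x = fact n * ((inverse U * fps_exp x) $ n)"
      unfolding bernoulli_polynomial_def D_def [symmetric] gf by (simp add: mult.commute)
    also have "\<dots> = (\<Sum>j\<le>n. fact n * (inverse U $ j * (x ^ (n - j) / fact (n - j))))"
      by (simp add: fps_mult_nth sum_distrib_left atMost_atLeast0)
    also have "\<dots> = appell P n x"
      unfolding appell_def by (intro sum.cong refl) (simp add: P_def binomial_fact)
    finally show ?thesis .
  qed
  have "P 0 = 1" by (simp add: P_def U0)
  from that[of P, OF this eq diff] show ?thesis .
qed

lemma bernoulli_polynomial_0 [simp]: "bernoulli_polynomial 0 x = 1"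
proof -
  obtain P where "P 0 = 1" "\<And>n x. bernoulli_polynomial n x = appell P n x"
    by (rule bernoulli_polynomial_appell) (rule that)
  thus ?thesis by simp
qed

lemma bernoulli_polynomial_1_diff: 
  "bernoulli_polynomial n 1 - bernoulli_polynomial n 0 = (if n = 1 then 1 else 0)"
  by (rule bernoulli_polynomial_appell) blast

lemma bernoulli_polynomial_deriv:
  "(bernoulli_polynomial (Suc n) has_field_derivative of_nat (Suc n) * bernoulli_polynomial n x) (at x)"
proof -
  obtain P where P: "\<And>n x. bernoulli_polynomial n x = appell P n x"
    by (rule bernoulli_polynomial_appell) (rule that)
  have [abs_def]: "bernoulli_polynomial n = appell P n" for n
    by (rule ext) (rule P)
  thus ?thesis using appell_Suc_deriv[of P n x] by simp
qed

lemma continuous_on_bernoulli_polynomial: "continuous_on S (bernoulli_polynomial n)"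
proof -
  obtain P where P: "\<And>n x. bernoulli_polynomial n x = appell P n x"
    by (rule bernoulli_polynomial_appell) (rule that)
  have "bernoulli_polynomial n = appell P n"
    by (rule ext) (rule P)
  thus ?thesis by (simp add: continuous_on_appell[OF continuous_on_id])
qed

text \<open>Supplies the Fourier coefficient at k = 0, where for z = 0 the recurrence would divide
  by zero.\<close>

lemma bernoulli_polynomial_has_integral_0:
  assumes "n > 0"
  shows "(bernoulli_polynomial n has_integral 0) {0..1}"
proof -
  have "((\<lambda>x. of_nat (Suc n) * bernoulli_polynomial n x) has_integral
           bernoulli_polynomial (Suc n) 1 - bernoulli_polynomial (Suc n) 0) {0..1}"
    by (intro fundamental_theorem_of_calculus has_vector_derivative_at_within
          [OF has_real_derivative_iff_has_vector_derivative[THEN iffD1, OF bernoulli_polynomial_deriv]]) simp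
  also have "bernoulli_polynomial (Suc n) 1 - bernoulli_polynomial (Suc n) 0 = 0"
    using assms by (simp add: bernoulli_polynomial_1_diff)
  finally have "((\<lambda>x. inverse (of_nat (Suc n)) * (of_nat (Suc n) * bernoulli_polynomial n x))
    has_integral inverse (of_nat (Suc n)) * 0) {0..1}"
    by (rule has_integral_mult_right)
  thus ?thesis unfolding mult.assoc [symmetric] by simp
qed

section \<open>Sums over the integers and growth of lattice points\<close>

lemma has_sum_int:
  fixes f :: "int \<Rightarrow> 'a::topological_comm_monoid_add"
  assumes "((\<lambda>n. f (int (Suc n))) has_sum A) UNIV" "((\<lambda>n. f (- int (Suc n))) has_sum B) UNIV"
  shows "(f has_sum (f 0 + (A + B))) UNIV"
proof -
  have 1: "bij_betw (\<lambda>n. int (Suc n)) UNIV {0<..}"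
    by (rule bij_betwI[of _ _ _ "\<lambda>n. nat n - 1"]) auto
  have 2: "bij_betw (\<lambda>n. - int (Suc n)) UNIV {..<0}"
    by (rule bij_betwI[of _ _ _ "\<lambda>n. nat (-n) - 1"]) auto
  have "(f has_sum (A + B)) ({0<..} \<union> {..<0})"
    using assms unfolding has_sum_reindex_bij_betw[OF 1] has_sum_reindex_bij_betw[OF 2]
    by (rule has_sum_Un_disjoint) auto
  hence "(f has_sum (f 0 + (A + B))) (insert 0 ({0<..} \<union> {..<0}))"
    by (rule has_sum_insert[rotated]) auto
  also have "insert 0 ({0<..} \<union> {..<0}) = (UNIV :: int set)" by auto
  finally show ?thesis .
qed

lemma summable_on_int_powr:
  assumes "s > 1"
  shows "(\<lambda>n::int. (1 + \<bar>real_of_int n\<bar>) powr (- s)) summable_on UNIV"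
proof -
  have "summable (\<lambda>n. real n powr (- s))"
    using assms by (subst summable_real_powr_iff) auto
  hence "summable (\<lambda>n. real (Suc (Suc n)) powr (- s))"
    using summable_Suc_iff[of "\<lambda>n. real n powr (- s)"] summable_Suc_iff[of "\<lambda>n. real (Suc n) powr (- s)"]
    by blast
  hence "(\<lambda>n. (2 + real n) powr (- s)) summable_on UNIV"
    by (intro summable_nonneg_imp_summable_on) (auto simp: add_ac)
  then obtain A where A: "((\<lambda>n. (2 + real n) powr (- s)) has_sum A) UNIV"
    unfolding summable_on_def by blast
  have "((\<lambda>n::int. (1 + \<bar>real_of_int n\<bar>) powr (- s)) has_sum 
           ((1 + \<bar>real_of_int 0\<bar>) powr (- s) + (A + A))) UNIV"
    by (rule has_sum_int) (use A in \<open>simp_all add: add_ac\<close>)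
  thus ?thesis unfolding summable_on_def by blast
qed

text \<open>The imaginary part gives |m| Im \<tau> \<le> |m\<tau> + n|, and the triangle inequality
  |n| \<le> |m\<tau> + n| + |m| |\<tau>|. Adding the two resulting bounds for |m| and |n| yields
  this constant.\<close>

definition lattice_const :: "complex \<Rightarrow> real" where
  "lattice_const \<tau> = 1 / Im \<tau> + 1 + norm \<tau> / Im \<tau>"

lemma lattice_const_ge_1: "Im \<tau> > 0 \<Longrightarrow> lattice_const \<tau> \<ge> 1"
  by (simp add: lattice_const_def)

lemma lattice_bound:
  assumes "Im \<tau> > 0"
  shows "\<bar>real_of_int m\<bar> + \<bar>real_of_int n\<bar> \<le> lattice_const \<tau> * norm (of_int m * \<tau> + of_int n)"
proof -
  let ?N = "norm (of_int m * \<tau> + of_int n)"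
  have "\<bar>real_of_int m\<bar> * Im \<tau> = \<bar>Im (of_int m * \<tau> + of_int n)\<bar>"
    using assms by (simp add: abs_mult)
  also have "\<dots> \<le> ?N" by (rule abs_Im_le_cmod)
  finally have m: "\<bar>real_of_int m\<bar> \<le> ?N / Im \<tau>"
    using assms by (simp add: field_simps)
  have "\<bar>real_of_int n\<bar> = norm ((of_int m * \<tau> + of_int n) - of_int m * \<tau>)"
    by simp
  also have "\<dots> \<le> ?N + \<bar>real_of_int m\<bar> * norm \<tau>"
    by (rule order.trans[OF norm_triangle_ineq4]) (simp add: norm_mult)
  also have "\<dots> \<le> ?N + ?N / Im \<tau> * norm \<tau>"
    by (intro add_left_mono mult_right_mono m) auto
  finally show ?thesis using m by (simp add: lattice_const_def algebra_simps add_divide_distrib)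
qed

lemma summable_on_inverse_power_shift:
  assumes "Im z > 0" "n \<ge> 2"
  shows "(\<lambda>k::int. norm (1 / (z + of_int k) ^ n)) summable_on UNIV"
proof (rule Infinite_Sum.abs_summable_on_comparison_test')
  define K where "K = lattice_const z"
  have K: "K > 0" using lattice_const_ge_1[OF assms(1)] by (simp add: K_def)
  show "(\<lambda>k::int. K ^ n * (1 + \<bar>real_of_int k\<bar>) powr (- 2)) summable_on UNIV"
    by (intro summable_on_cmult_right summable_on_int_powr) auto
  fix k :: int
  have "1 + \<bar>real_of_int k\<bar> \<le> K * norm (z + of_int k)"
    using lattice_bound[OF assms(1), of 1 k] by (simp add: K_def)
  hence "(1 + \<bar>real_of_int k\<bar>) ^ n \<le> (K * norm (z + of_int k)) ^ n"
    by (intro power_mono) auto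
  moreover have "(1 + \<bar>real_of_int k\<bar>) ^ 2 \<le> (1 + \<bar>real_of_int k\<bar>) ^ n"
    using assms(2) by (intro power_increasing) auto
  ultimately have le: "(1 + \<bar>real_of_int k\<bar>) ^ 2 \<le> K ^ n * norm (z + of_int k) ^ n"
    by (simp add: power_mult_distrib)
  have gen: "1 / b \<le> L / c" if "c \<le> L * b" "b > 0" "c > 0" for b c L :: real
    using that by (simp add: field_simps)
  have "norm (z + of_int k) > 0"
    using assms(1) by (auto simp: complex_eq_iff)
  hence "norm (z + of_int k) ^ n > 0" by simp
  hence "1 / norm (z + of_int k) ^ n \<le> K ^ n / (1 + \<bar>real_of_int k\<bar>) ^ 2"
    by (intro gen le) auto
  moreover have "(1 + \<bar>real_of_int k\<bar>) powr (- 2) = 1 / (1 + \<bar>real_of_int k\<bar>) ^ 2"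
    by (simp add: powr_minus inverse_eq_divide powr_numeral)
  ultimately show "norm (1 / (z + of_int k) ^ n) \<le> K ^ n * (1 + \<bar>real_of_int k\<bar>) powr (- 2)"
    by (simp add: norm_divide norm_power)
qed

text \<open>A single term of the exponential series is at most the whole. The rate c is left free so
  that callers decide how much exponential decay to spend on absorbing a power.\<close>

lemma power_le_exp:
  assumes "x \<ge> 0" "c > (0::real)"
  shows "x ^ n \<le> fact n / c ^ n * exp (c * x)"
proof -
  have "(c * x) ^ n / fact n \<le> exp (c * x)"
  proof -
    have "(c * x) ^ n / fact n = (\<Sum>k\<in>{n}. (c * x) ^ k /\<^sub>R fact k)"
      by (simp add: field_simps)
    also have "\<dots> \<le> (\<Sum>k. (c * x) ^ k /\<^sub>R fact k)"
      using assms by (intro sum_le_suminf summable_exp_generic) auto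
    also have "\<dots> = exp (c * x)" by (simp add: exp_def)
    finally show ?thesis .
  qed
  thus ?thesis using assms by (simp add: power_mult_distrib field_simps)
qed

subsection \<open>Lipschitz summation\<close>

text \<open>The functions A_n = -B_(n+1) / (n + 1) satisfy the Appell recurrence with z = 0 and
  \<kappa> = -1, because B_0 = 1. The term k = 0 of the series is 0 by the convention for division
  by zero, as required.\<close>

lemma bernoulli_fourier:
  assumes "a \<ge> 2" "0 \<le> x" "x \<le> 1"
  shows "((\<lambda>k::int. qexp (- (of_int k * of_real x)) / of_int k ^ a) has_sum
            (- ((- 2 * of_real pi * \<i>) ^ a / fact (a - 1)) * of_real (bernoulli_polynomial a x / real a))) UNIV"
proof -
  define A where "A = (\<lambda>n x. - complex_of_real (bernoulli_polynomial (Suc n) x / real (Suc n)))"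
  define w where "w = (- 2 * of_real pi * \<i> :: complex)"
  have w: "w \<noteq> 0" by (simp add: w_def)
  define n where "n = a - 2"
  have a: "a = Suc (Suc n)" using assms(1) by (simp add: n_def)
  have cancel: "W / f * (f / (W * Z) * q) = q / Z" if "W \<noteq> 0" "f \<noteq> 0" for W f Z q :: complex
    using that by simp
  have deriv: "(A n has_vector_derivative - complex_of_real (bernoulli_polynomial n x)) (at x)" for n x
  proof -
    have "((\<lambda>x. complex_of_real (bernoulli_polynomial (Suc n) x)) has_vector_derivative
             of_real (real (Suc n) * bernoulli_polynomial n x)) (at x)"
      by (rule has_vector_derivative_of_real[OF bernoulli_polynomial_deriv])
    from has_vector_derivative_mult_right[OF this, of "- (1 / of_nat (Suc n))"]
    show ?thesis by (simp add: A_def del: of_nat_Suc)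
  qed
  have coeff: "((\<lambda>x. A n x * qexp (of_int k * of_real x)) has_integral
            (fact n / (w * (0 + of_int k)) ^ Suc n)) {0..1}" if "k \<noteq> 0" for n and k :: int
    unfolding w_def
  proof (rule fourier_coeff_appell[where \<kappa> = "-1"])
    show "(A 0 has_vector_derivative - 1 + 2 * of_real pi * \<i> * 0 * A 0 x) (at x)" for x
      using deriv[of 0 x] by simp
    show "(A (Suc n) has_vector_derivative of_nat (Suc n) * A n x + 2 * of_real pi * \<i> * 0 * A (Suc n) x) (at x)" for n x
    proof -
      have "of_nat (Suc n) * A n x + 2 * of_real pi * \<i> * 0 * A (Suc n) x = - of_real (bernoulli_polynomial (Suc n) x)"
        by (simp add: A_def del: of_nat_Suc)
      thus ?thesis using deriv[of "Suc n" x] by simp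
    qed
    show "A 0 1 = A 0 0 - 1" using bernoulli_polynomial_1_diff[of 1]
      by (simp add: A_def algebra_simps flip: of_real_diff of_real_add)
    show "A (Suc n) 1 = A (Suc n) 0" for n using bernoulli_polynomial_1_diff[of "Suc (Suc n)"]
      by (simp add: A_def)
  qed (use that in auto)
  define c where "c = (\<lambda>k::int. fact (Suc n) / (w * of_int k) ^ a)"
  \<comment> \<open>At k = 0 the formula for \<open>c\<close> reads as division by zero, hence 0,
    and this agrees with the vanishing mean of B_a.\<close>
  have coeff': "((\<lambda>x. A (Suc n) x * qexp (of_int k * of_real x)) has_integral c k) {0..1}" for k
  proof (cases "k = 0")
    case False
    with coeff[of k "Suc n"] show ?thesis by (simp add: c_def a)
  next
    case True
    have "((\<lambda>x. - (complex_of_real (bernoulli_polynomial a x) / of_nat a)) has_integral - (complex_of_real 0 / of_nat a)) {0..1}"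
      using assms
      by (intro has_integral_neg has_integral_divide has_integral_of_real bernoulli_polynomial_has_integral_0) auto
    thus ?thesis using True by (simp add: A_def a c_def)
  qed
  have "((\<lambda>k. c k * qexp (- (of_int k * of_real x))) has_sum A (Suc n) x) UNIV"
  proof (rule fourier_inversion[OF _ _ coeff'])
    show "continuous_on {0..1} (A (Suc n))"
      unfolding A_def by (intro continuous_intros continuous_on_bernoulli_polynomial) simp
    show "A (Suc n) 0 = A (Suc n) 1" 
      using bernoulli_polynomial_1_diff[of "Suc (Suc n)"] by (simp add: A_def)
    show "x \<in> {0..1}" using assms by auto
    show "(\<lambda>k. norm (c k)) summable_on UNIV"
    proof (rule summable_on_comparison_test)
      \<comment> \<open>The factor 2^a comes from 1 + |k| \<le> 2|k| for k \<noteq> 0.\<close>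
      define C where "C = norm (fact (Suc n) / w ^ a) * 2 ^ a"
      show "(\<lambda>k::int. C * (1 + \<bar>real_of_int k\<bar>) powr (- 2)) summable_on UNIV"
        by (intro summable_on_cmult_right summable_on_int_powr) auto
      fix k :: int
      show "norm (c k) \<le> C * (1 + \<bar>real_of_int k\<bar>) powr (- 2)"
      proof (cases "k = 0")
        case False
        hence k: "\<bar>real_of_int k\<bar> \<ge> 1" by linarith
        have "(1 + \<bar>real_of_int k\<bar>) ^ 2 \<le> (1 + \<bar>real_of_int k\<bar>) ^ a"
          using assms by (intro power_increasing) auto
        also have "\<dots> \<le> (2 * \<bar>real_of_int k\<bar>) ^ a"
          using k by (intro power_mono) auto
        finally have "(1 + \<bar>real_of_int k\<bar>) ^ 2 \<le> 2 ^ a * \<bar>real_of_int k\<bar> ^ a"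
          by (simp add: power_mult_distrib)
        moreover have gen: "1 / b \<le> L / c" if "c \<le> L * b" "b > 0" "c > 0" for b c L :: real
          using that by (simp add: field_simps)
        ultimately have "1 / \<bar>real_of_int k\<bar> ^ a \<le> 2 ^ a / (1 + \<bar>real_of_int k\<bar>) ^ 2"
          using False by (intro gen) auto
        hence "norm (fact (Suc n) / w ^ a) * (1 / \<bar>real_of_int k\<bar> ^ a) \<le>
               norm (fact (Suc n) / w ^ a) * (2 ^ a / (1 + \<bar>real_of_int k\<bar>) ^ 2)"
          by (intro mult_left_mono) auto
        also have "norm (fact (Suc n) / w ^ a) * (1 / \<bar>real_of_int k\<bar> ^ a) = norm (c k)"
          by (simp add: c_def norm_divide norm_mult norm_power power_mult_distrib)
        finally show ?thesis
          by (simp add: C_def powr_minus powr_numeral divide_inverse)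
      qed (auto simp: c_def a C_def)
    qed auto
  qed
  from has_sum_cmult_right[OF this, of "w ^ a / fact (a - 1)"]
  have "((\<lambda>k. w ^ a / fact (a - 1) * (c k * qexp (- (of_int k * of_real x)))) has_sum
           (w ^ a / fact (a - 1) * A (Suc n) x)) UNIV" .
  also have "(\<lambda>k. w ^ a / fact (a - 1) * (c k * qexp (- (of_int k * of_real x)))) = 
             (\<lambda>k::int. qexp (- (of_int k * of_real x)) / of_int k ^ a)"
    unfolding c_def power_mult_distrib a diff_Suc_1 by (intro ext cancel) (use w in \<open>auto simp del: fact_Suc\<close>)
  also have "w ^ a / fact (a - 1) * A (Suc n) x = 
     (- ((- 2 * of_real pi * \<i>) ^ a / fact (a - 1)) * of_real (bernoulli_polynomial a x / real a))"
    by (simp add: A_def a w_def del: power_Suc fact_Suc of_nat_Suc)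
  finally show ?thesis .
qed

text \<open>Replacing k by -k in the Fourier series yields the factor (-1)^a, and e(k) = 1 turns the
  character of 1 - x into that of x. Uniqueness of the sum finishes.\<close>

lemma bernoulli_polynomial_reflect:
  assumes "a \<ge> 2" "0 \<le> x" "x \<le> 1"
  shows "bernoulli_polynomial a (1 - x) = (-1) ^ a * bernoulli_polynomial a x"
proof -
  define C where "C = - ((- 2 * of_real pi * \<i>) ^ a / fact (a - 1) :: complex)"
  have C: "C \<noteq> 0" by (simp add: C_def)
  have "((\<lambda>k::int. (-1) ^ a * (qexp (- (of_int (-k) * of_real (1 - x))) / of_int (-k) ^ a)) has_sum
            (-1) ^ a * (C * of_real (bernoulli_polynomial a (1 - x) / real a))) UNIV"
    using bernoulli_fourier[of a "1 - x"] assms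
    by (intro has_sum_cmult_right, subst has_sum_reindex_bij_betw[of uminus UNIV UNIV]) 
       (auto simp: C_def intro!: bij_betwI[of _ _ _ uminus])
  also have "(\<lambda>k::int. (-1) ^ a * (qexp (- (of_int (-k) * of_real (1 - x))) / of_int (-k) ^ a)) =
             (\<lambda>k::int. qexp (- (of_int k * of_real x)) / of_int k ^ a)"
  proof
    fix k :: int
    have "qexp (- (of_int (-k) * of_real (1 - x))) = qexp (of_int k + - (of_int k * of_real x))"
      by (simp add: algebra_simps)
    also have "\<dots> = qexp (- (of_int k * of_real x))" by (subst qexp_add) simp
    finally show "(-1) ^ a * (qexp (- (of_int (-k) * of_real (1 - x))) / of_int (-k) ^ a) =
             qexp (- (of_int k * of_real x)) / of_int k ^ a"
      by (cases "even a") simp_all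
  qed
  finally have "(-1) ^ a * (C * of_real (bernoulli_polynomial a (1 - x) / real a)) =
        C * of_real (bernoulli_polynomial a x / real a)"
    using bernoulli_fourier[OF assms] unfolding C_def by (rule has_sum_unique)
  hence "C * of_real ((-1) ^ a * bernoulli_polynomial a (1 - x)) = C * of_real (bernoulli_polynomial a x)"
    using assms by (simp add: field_simps)
  hence "complex_of_real ((-1) ^ a * bernoulli_polynomial a (1 - x)) = of_real (bernoulli_polynomial a x)"
    using C by (simp del: of_real_mult)
  hence "(-1) ^ a * bernoulli_polynomial a (1 - x) = bernoulli_polynomial a x"
    by (simp only: of_real_eq_iff)
  thus ?thesis by (cases "even a") auto
qed

section \<open>The Lerch series and its Fourier expansion\<close>

definition lerch :: "nat \<Rightarrow> complex \<Rightarrow> real \<Rightarrow> complex" where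
  "lerch n z x = (\<Sum>l. of_real (real l + x) ^ n * qexp (of_real (real l + x) * z))"

text \<open>Half of the decay exp(-2\<pi> Im z (l + x)) absorbs the n-th power; the other half
  remains for geometric comparison.\<close>

lemma norm_lerch_term_le:
  assumes "x \<ge> 0" "Im z > 0"
  shows "norm (of_real (real l + x) ^ n * qexp (of_real (real l + x) * z)) \<le>
           fact n / (pi * Im z) ^ n * exp (- (pi * Im z) * (real l + x))"
proof -
  have "norm (of_real (real l + x) ^ n * qexp (of_real (real l + x) * z)) =
        (real l + x) ^ n * exp (- 2 * pi * Im z * (real l + x))"
    unfolding norm_mult norm_power norm_qexp norm_of_real using assms by (simp add: mult.assoc mult.commute)
  also have "\<dots> \<le> (fact n / (pi * Im z) ^ n * exp (pi * Im z * (real l + x))) * exp (- 2 * pi * Im z * (real l + x))"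
    using assms by (intro mult_right_mono power_le_exp) auto
  also have "\<dots> = fact n / (pi * Im z) ^ n * exp (pi * Im z * (real l + x) + - 2 * pi * Im z * (real l + x))"
    by (simp only: exp_add mult.assoc)
  also have "pi * Im z * (real l + x) + - 2 * pi * Im z * (real l + x) = - (pi * Im z) * (real l + x)"
    by (simp add: algebra_simps)
  finally show ?thesis .
qed

lemma summable_lerch:
  assumes "x \<ge> 0" "Im z > 0"
  shows "summable (\<lambda>l. norm (of_real (real l + x) ^ n * qexp (of_real (real l + x) * z)))"
proof (rule summable_comparison_test')
  have "exp (- (pi * Im z)) < 1" using assms by simp
  hence "summable (\<lambda>l. fact n / (pi * Im z) ^ n * exp (- (pi * Im z) * x) * exp (- (pi * Im z)) ^ l)"
    by (intro summable_mult summable_geometric) auto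
  also have "(\<lambda>l. fact n / (pi * Im z) ^ n * exp (- (pi * Im z) * x) * exp (- (pi * Im z)) ^ l) =
             (\<lambda>l. fact n / (pi * Im z) ^ n * exp (- (pi * Im z) * (real l + x)))"
    by (simp only: mult.assoc exp_of_nat_mult [symmetric] exp_add [symmetric] distrib_left mult.commute[of "real _"] add.commute)
  finally show "summable (\<lambda>l. fact n / (pi * Im z) ^ n * exp (- (pi * Im z) * (real l + x)))" .
qed (use norm_lerch_term_le[OF assms] in auto)

lemma lerch_sums:
  assumes "x \<ge> 0" "Im z > 0"
  shows "(\<lambda>l. of_real (real l + x) ^ n * qexp (of_real (real l + x) * z)) sums lerch n z x"
  unfolding lerch_def by (intro summable_sums summable_norm_cancel[OF summable_lerch] assms)

lemma lerch_has_sum: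
  assumes "x \<ge> 0" "Im z > 0"
  shows "((\<lambda>l. of_real (real l + x) ^ n * qexp (of_real (real l + x) * z)) has_sum lerch n z x) UNIV"
  by (intro norm_summable_imp_has_sum lerch_sums summable_lerch assms)

text \<open>Binomial expansion of (l + x)^n. The right-hand side is a finite expression in x, so it
  can be differentiated without differentiating an infinite series, and it satisfies the recurrence
  at every real x, also at negative ones.\<close>

lemma lerch_eq_appell:
  assumes "x \<ge> 0" "Im z > 0"
  shows "lerch n z x = qexp (of_real x * z) * appell (\<lambda>j. lerch j z 0) n (of_real x)"
proof -
  have "(\<lambda>l. qexp (of_real x * z) * (\<Sum>j\<le>n. of_nat (n choose j) * (of_real (real l + 0) ^ j * qexp (of_real (real l + 0) * z)) *
            of_real x ^ (n - j))) sums (qexp (of_real x * z) * appell (\<lambda>j. lerch j z 0) n (of_real x))"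
    unfolding appell_def by (intro sums_mult sums_sum sums_mult2 lerch_sums assms) auto
  also have "(\<lambda>l. qexp (of_real x * z) * (\<Sum>j\<le>n. of_nat (n choose j) * (of_real (real l + 0) ^ j * qexp (of_real (real l + 0) * z)) *
            of_real x ^ (n - j))) = (\<lambda>l. of_real (real l + x) ^ n * qexp (of_real (real l + x) * z))"
  proof
    fix l
    have "of_real (real l + x) ^ n = (\<Sum>j\<le>n. of_nat (n choose j) * of_real (real l) ^ j * complex_of_real x ^ (n - j))"
      by (simp add: binomial_ring)
    moreover have "qexp (of_real (real l + x) * z) = qexp (of_real x * z) * qexp (of_real (real l) * z)"
      by (simp add: distrib_right qexp_add)
    ultimately show "qexp (of_real x * z) * (\<Sum>j\<le>n. of_nat (n choose j) * (of_real (real l + 0) ^ j * qexp (of_real (real l + 0) * z)) *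
            of_real x ^ (n - j)) = of_real (real l + x) ^ n * qexp (of_real (real l + x) * z)"
      by (simp add: sum_distrib_left sum_distrib_right mult_ac)
  qed
  finally show ?thesis
    using lerch_sums[OF assms, of n] by (rule sums_unique2 [symmetric])
qed

text \<open>Passing from x = 0 to x = 1 drops the term l = 0, whose value 0^n is nonzero only for n
  = 0. This is the boundary jump of the Appell recurrence.\<close>

lemma lerch_1:
  assumes "Im z > 0"
  shows "lerch n z 1 = lerch n z 0 - 0 ^ n"
proof -
  have "(\<lambda>l. of_real (real (Suc l) + 0) ^ n * qexp (of_real (real (Suc l) + 0) * z)) sums
          (lerch n z 0 - of_real (real 0 + 0) ^ n * qexp (of_real (real 0 + 0) * z))"
    using lerch_sums[of 0 z n] assms by (subst sums_Suc_iff) simp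
  moreover have "(\<lambda>l. of_real (real l + 1) ^ n * qexp (of_real (real l + 1) * z)) sums lerch n z 1"
    using assms by (intro lerch_sums) auto
  ultimately show ?thesis by (simp add: add_ac sums_unique2)
qed

text \<open>The Appell recurrence with \<kappa> = 0, applied to the finite form of the Lerch series.
  Since Im z > 0, no z + k vanishes and k = 0 is not exceptional.\<close>

lemma lipschitz_character:
  assumes "a \<ge> 2" "0 \<le> x" "x \<le> 1" "Im z > 0"
  shows "((\<lambda>k::int. qexp (- (of_int k * of_real x)) / (z + of_int k) ^ a) has_sum
            ((- 2 * of_real pi * \<i>) ^ a / fact (a - 1) * lerch (a - 1) z x)) UNIV"
proof -
  define A where "A = (\<lambda>n x. qexp (of_real x * z) * appell (\<lambda>j. lerch j z 0) n (of_real x))"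
  define w where "w = (- 2 * of_real pi * \<i> :: complex)"
  have w: "w \<noteq> 0" by (simp add: w_def)
  have A: "A n x = lerch n z x" if "x \<ge> 0" for n x
    using lerch_eq_appell[OF that assms(4), of n] by (simp add: A_def)
  define n where "n = a - 2"
  have a: "a = Suc (Suc n)" using assms(1) by (simp add: n_def)
  have cancel: "W / f * (f / (W * Z) * q) = q / Z" if "W \<noteq> 0" "f \<noteq> 0" for W f Z q :: complex
    using that by simp
  have dq: "((\<lambda>x. qexp (x * z)) has_field_derivative 2 * of_real pi * \<i> * z * qexp (x * z)) (at x)" for x
    unfolding qexp_def by (auto intro!: derivative_eq_intros)
  have zk: "z + of_int k \<noteq> 0" for k
    using assms(4) by (auto simp: complex_eq_iff)
  define c where "c = (\<lambda>k::int. fact (Suc n) / (w * (z + of_int k)) ^ a)"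
  have coeff: "((\<lambda>x. A (Suc n) x * qexp (of_int k * of_real x)) has_integral c k) {0..1}" for k :: int
    unfolding c_def w_def a
  proof (rule fourier_coeff_appell[where \<kappa> = 0])
    show "(A 0 has_vector_derivative 0 + 2 * of_real pi * \<i> * z * A 0 x) (at x)" for x
    proof -
      have "((\<lambda>x. qexp (x * z) * lerch 0 z 0) has_field_derivative 
          2 * of_real pi * \<i> * z * qexp (of_real x * z) * lerch 0 z 0) (at (of_real x))"
        by (rule DERIV_cmult_right[OF dq])
      from has_vector_derivative_real_field[OF this] show ?thesis
        by (simp add: A_def mult.assoc)
    qed
    show "(A (Suc n) has_vector_derivative of_nat (Suc n) * A n x + 2 * of_real pi * \<i> * z * A (Suc n) x) (at x)" for n x
    proof -
      have "((\<lambda>x. qexp (x * z) * appell (\<lambda>j. lerch j z 0) (Suc n) x) has_field_derivative 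
          2 * of_real pi * \<i> * z * qexp (of_real x * z) * appell (\<lambda>j. lerch j z 0) (Suc n) (of_real x) +
          of_nat (Suc n) * appell (\<lambda>j. lerch j z 0) n (of_real x) * qexp (of_real x * z)) (at (of_real x))"
        by (rule DERIV_mult[OF dq appell_Suc_deriv])
      from has_vector_derivative_real_field[OF this] show ?thesis
        by (simp add: A_def mult_ac add_ac del: of_nat_Suc)
    qed
    show "A 0 1 = A 0 0 - 1" "A (Suc n) 1 = A (Suc n) 0" for n
      using assms by (simp_all add: A lerch_1)
  qed (use zk in auto)
  have "((\<lambda>k. c k * qexp (- (of_int k * of_real x))) has_sum A (Suc n) x) UNIV"
  proof (rule fourier_inversion[OF _ _ coeff])
    show "continuous_on {0..1} (A (Suc n))"
      unfolding A_def by (intro continuous_intros)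
    show "A (Suc n) 0 = A (Suc n) 1" 
      using assms by (simp add: A lerch_1)
    have "(\<lambda>k::int. norm (fact (Suc n) / w ^ a) * norm (1 / (z + of_int k) ^ a)) summable_on UNIV"
      by (intro summable_on_cmult_right summable_on_inverse_power_shift assms)
    thus "(\<lambda>k. norm (c k)) summable_on UNIV"
      by (simp add: c_def norm_divide norm_mult norm_power power_mult_distrib)
    show "x \<in> {0..1}" using assms by auto
  qed
  from has_sum_cmult_right[OF this, of "w ^ a / fact (a - 1)"]
  have "((\<lambda>k. w ^ a / fact (a - 1) * (c k * qexp (- (of_int k * of_real x)))) has_sum
           (w ^ a / fact (a - 1) * A (Suc n) x)) UNIV" .
  also have "(\<lambda>k. w ^ a / fact (a - 1) * (c k * qexp (- (of_int k * of_real x)))) = 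
             (\<lambda>k::int. qexp (- (of_int k * of_real x)) / (z + of_int k) ^ a)"
    unfolding c_def power_mult_distrib a diff_Suc_1 by (intro ext cancel) (use w in \<open>auto simp del: fact_Suc\<close>)
  finally show ?thesis using assms by (simp add: A a w_def)
qed

subsection \<open>The lattice sum and its symmetries\<close>

text \<open>The index m is shifted to start at 0, so that sums run over all pairs. With x = 1 -
  \<alpha> the second index is shifted as well: l - \<alpha> for l \<ge> 1 becomes l + (1 -
  \<alpha>) for l \<ge> 0, and one family covers both series of F.\<close>

definition lerch_double :: "nat \<Rightarrow> real \<Rightarrow> real \<Rightarrow> complex \<Rightarrow> nat \<times> nat \<Rightarrow> complex" where
  "lerch_double n x \<beta> \<tau> = (\<lambda>(m, l). qexp (of_nat (Suc m) * of_real \<beta>) *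
      (of_real (real l + x) ^ n * qexp (of_real (real l + x) * (of_nat (Suc m) * \<tau>))))"

text \<open>With c = \<pi> Im \<tau>, the inequality (m+1)(l+x) \<ge> (m+1)x + l separates the
  variables and bounds the terms by a product of two geometric series. Positivity of x makes the
  series in m converge.\<close>

lemma lerch_double_summable:
  assumes "x > 0" "Im \<tau> > 0"
  shows "(\<lambda>p. norm (lerch_double n x \<beta> \<tau> p)) summable_on UNIV"
proof (rule Infinite_Sum.abs_summable_on_comparison_test')
  define c where "c = pi * Im \<tau>"
  have c: "c > 0" using assms by (simp add: c_def)
  define f where "f = (\<lambda>m. fact n / c ^ n * exp (- (c * x)) ^ Suc m)"
  define g where "g = (\<lambda>l::nat. exp (- c) ^ l)"
  have "summable f"
    unfolding f_def power_Suc using c assms by (intro summable_mult summable_geometric) auto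
  hence f: "f summable_on UNIV"
    using c by (intro summable_nonneg_imp_summable_on) (auto simp: f_def)
  have "summable g"
    unfolding g_def using c by (intro summable_geometric) auto
  hence "g summable_on UNIV"
    by (intro summable_nonneg_imp_summable_on) (auto simp: g_def)
  then obtain G where G: "(g has_sum G) UNIV" by (auto simp: summable_on_def)
  have "(\<lambda>(m, l). f m * g l) summable_on (UNIV \<times> UNIV)"
  proof (rule summable_on_SigmaI)
    show "((\<lambda>y. case (m, y) of (m, l) \<Rightarrow> f m * g l) has_sum f m * G) UNIV" for m
      using has_sum_cmult_right[OF G] by simp
    show "(\<lambda>m. f m * G) summable_on UNIV"
      by (intro summable_on_cmult_left f)
  qed (use c in \<open>auto simp: f_def g_def\<close>)
  thus "(\<lambda>(m, l). f m * g l) summable_on UNIV" by simp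
  fix p :: "nat \<times> nat"
  obtain m l where p: "p = (m, l)" by force
  have "norm (lerch_double n x \<beta> \<tau> p) = norm (of_real (real l + x) ^ n * qexp (of_real (real l + x) * (of_nat (Suc m) * \<tau>)))"
  proof -
    have "norm (qexp (of_nat (Suc m) * of_real \<beta>)) = 1"
      using norm_qexp_of_real[of "real (Suc m) * \<beta>"] by simp
    thus ?thesis unfolding p lerch_double_def by (simp only: prod.case norm_mult mult_1)
  qed
  also have "\<dots> \<le> fact n / (pi * Im (of_nat (Suc m) * \<tau>)) ^ n * exp (- (pi * Im (of_nat (Suc m) * \<tau>)) * (real l + x))"
    by (rule norm_lerch_term_le) (use assms in \<open>simp_all del: of_nat_Suc\<close>)
  also have "pi * Im (of_nat (Suc m) * \<tau>) = real (Suc m) * c"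
    by (simp add: c_def del: of_nat_Suc)
  also have "fact n / (real (Suc m) * c) ^ n * exp (- (real (Suc m) * c) * (real l + x)) \<le> fact n / c ^ n * (exp (- (c * x)) ^ Suc m * exp (- c) ^ l)"
  proof (rule mult_mono)
    have "c \<le> real (Suc m) * c" using c by simp
    thus "fact n / (real (Suc m) * c) ^ n \<le> fact n / c ^ n"
      using c by (intro divide_left_mono power_mono mult_pos_pos zero_less_power) auto
    have "c * (real l * 1) \<le> c * (real l * real (Suc m))"
      using c by (intro mult_left_mono) auto
    hence "- (real (Suc m) * c) * (real l + x) \<le> real (Suc m) * (- (c * x)) + real l * (- c)"
      by (simp add: algebra_simps)
    thus "exp (- (real (Suc m) * c) * (real l + x)) \<le> exp (- (c * x)) ^ Suc m * exp (- c) ^ l"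
      by (simp only: exp_of_nat_mult [symmetric] exp_add [symmetric] exp_le_cancel_iff)
  qed (use c in auto)
  finally show "norm (lerch_double n x \<beta> \<tau> p) \<le> (case p of (m, l) \<Rightarrow> f m * g l)"
    unfolding p f_def g_def prod.case by (simp only: mult.assoc)
qed

lemma lerch_double_has_sum:
  assumes "x > 0" "Im \<tau> > 0"
  shows "(lerch_double n x \<beta> \<tau> has_sum infsum (lerch_double n x \<beta> \<tau>) UNIV) UNIV"
  by (rule has_sum_infsum[OF abs_summable_summable[OF lerch_double_summable[OF assms]]])

lemma lerch_double_rows:
  assumes "x > 0" "Im \<tau> > 0"
  shows "((\<lambda>m. qexp (of_nat (Suc m) * of_real \<beta>) * lerch n (of_nat (Suc m) * \<tau>) x) has_sum
            infsum (lerch_double n x \<beta> \<tau>) UNIV) UNIV"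
proof (rule has_sum_SigmaD)
  show "(lerch_double n x \<beta> \<tau> has_sum infsum (lerch_double n x \<beta> \<tau>) UNIV) (UNIV \<times> UNIV)"
    using lerch_double_has_sum[OF assms] by simp
  show "((\<lambda>l. lerch_double n x \<beta> \<tau> (m, l)) has_sum
          qexp (of_nat (Suc m) * of_real \<beta>) * lerch n (of_nat (Suc m) * \<tau>) x) UNIV" for m
    unfolding lerch_double_def prod.case
    by (intro has_sum_cmult_right lerch_has_sum) (use assms in \<open>simp_all del: of_nat_Suc\<close>)
qed

lemma F_char_eq_lerch_double:
  "F_char a \<alpha> \<beta> \<tau> = of_real (bernoulli_polynomial a \<alpha> / real a) -
     ((-1) ^ a * infsum (lerch_double (a - 1) (1 - \<alpha>) \<beta> \<tau>) UNIV +
      infsum (lerch_double (a - 1) \<alpha> (- \<beta>) \<tau>) UNIV)"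
proof -
  have "(\<Sum>\<^sub>\<infinity>(m, l)\<in>{1::nat..} \<times> {1::nat..}.
          of_real ((real l - \<alpha>) ^ (a - 1)) * exp (2 * pi * \<i> * of_nat m * of_real \<beta>)
            * exp (2 * pi * \<i> * of_nat m * of_real (real l - \<alpha>) * \<tau>)) = 
        infsum (lerch_double (a - 1) (1 - \<alpha>) \<beta> \<tau>) UNIV"
    by (rule infsum_reindex_bij_witness[of _ "\<lambda>(m, l). (Suc m, Suc l)" "\<lambda>(m, l). (m - 1, l - 1)"])
       (auto simp: lerch_double_def qexp_def of_nat_diff mult_ac)
  moreover have "(\<Sum>\<^sub>\<infinity>(m, l)\<in>{1::nat..} \<times> {0::nat..}.
          of_real ((real l + \<alpha>) ^ (a - 1)) * exp (- 2 * pi * \<i> * of_nat m * of_real \<beta>)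
            * exp (2 * pi * \<i> * of_nat m * of_real (real l + \<alpha>) * \<tau>)) =
        infsum (lerch_double (a - 1) \<alpha> (- \<beta>) \<tau>) UNIV"
    by (rule infsum_reindex_bij_witness[of _ "\<lambda>(m, l). (Suc m, l)" "\<lambda>(m, l). (m - 1, l)"])
       (auto simp: lerch_double_def qexp_def of_nat_diff mult_ac)
  ultimately show ?thesis unfolding F_char_def by simp
qed

text \<open>For m = 0 this is the Bernoulli series, for m > 0 Lipschitz summation at m\<tau>. For m
  < 0 the point m\<tau> lies in the lower half-plane; changing the signs of both m and n costs
  (-1)^a and replaces x by 1 - x.\<close>

lemma lattice_row_has_sum:
  assumes "a \<ge> 2" "0 \<le> x" "x \<le> 1" "Im \<tau> > 0"
  shows "((\<lambda>n::int. qexp (- (of_int n * of_real x)) / (of_int m * \<tau> + of_int n) ^ a) has_sum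
            ((- 2 * of_real pi * \<i>) ^ a / fact (a - 1) *
              (if m = 0 then - of_real (bernoulli_polynomial a x / real a)
               else if m > 0 then lerch (a - 1) (of_int m * \<tau>) x
               else (-1) ^ a * lerch (a - 1) (of_int (- m) * \<tau>) (1 - x)))) UNIV"
proof -
  define C :: complex where "C = (- 2 * of_real pi * \<i>) ^ a / fact (a - 1)"
  consider "m = 0" | "m > 0" | "m < 0" by linarith
  thus ?thesis unfolding C_def [symmetric]
  proof cases
    assume "m = 0"
    thus "((\<lambda>n::int. qexp (- (of_int n * of_real x)) / (of_int m * \<tau> + of_int n) ^ a) has_sum
            (C * (if m = 0 then - of_real (bernoulli_polynomial a x / real a)
               else if m > 0 then lerch (a - 1) (of_int m * \<tau>) x
               else (-1) ^ a * lerch (a - 1) (of_int (- m) * \<tau>) (1 - x)))) UNIV"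
      using bernoulli_fourier[OF assms(1-3)] by (simp add: C_def)
  next
    assume "m > 0"
    thus "((\<lambda>n::int. qexp (- (of_int n * of_real x)) / (of_int m * \<tau> + of_int n) ^ a) has_sum
            (C * (if m = 0 then - of_real (bernoulli_polynomial a x / real a)
               else if m > 0 then lerch (a - 1) (of_int m * \<tau>) x
               else (-1) ^ a * lerch (a - 1) (of_int (- m) * \<tau>) (1 - x)))) UNIV"
      using lipschitz_character[OF assms(1-3), of "of_int m * \<tau>"] assms(4) by (simp add: C_def)
  next
    assume m: "m < 0"
    have "((\<lambda>n::int. (-1) ^ a * (qexp (- (of_int (- n) * of_real (1 - x))) / (of_int (- m) * \<tau> + of_int (- n)) ^ a))
             has_sum ((-1) ^ a * (C * lerch (a - 1) (of_int (- m) * \<tau>) (1 - x)))) UNIV"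
    proof (intro has_sum_cmult_right, subst has_sum_reindex_bij_betw[of uminus UNIV UNIV])
      show "bij (uminus :: int \<Rightarrow> int)" by (rule bij_uminus)
      have "Im (of_int (- m) * \<tau>) > 0" using m assms(4) by (simp add: mult_neg_pos)
      thus "((\<lambda>n::int. qexp (- (of_int n * of_real (1 - x))) / (of_int (- m) * \<tau> + of_int n) ^ a)
             has_sum (C * lerch (a - 1) (of_int (- m) * \<tau>) (1 - x))) UNIV"
        unfolding C_def using assms by (intro lipschitz_character) auto
    qed
    also have "(\<lambda>n::int. (-1) ^ a * (qexp (- (of_int (- n) * of_real (1 - x))) / (of_int (- m) * \<tau> + of_int (- n)) ^ a)) =
               (\<lambda>n::int. qexp (- (of_int n * of_real x)) / (of_int m * \<tau> + of_int n) ^ a)"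
    proof
      fix n :: int
      have "qexp (- (of_int (-n) * of_real (1 - x))) = qexp (of_int n + - (of_int n * of_real x))"
        by (simp add: algebra_simps)
      also have "\<dots> = qexp (- (of_int n * of_real x))" by (subst qexp_add) simp
      finally have q: "qexp (- (of_int (-n) * of_real (1 - x))) = qexp (- (of_int n * of_real x))" .
      have "(of_int (- m) * \<tau> + of_int (- n)) ^ a = (- (of_int m * \<tau> + of_int n)) ^ a"
        by simp
      also have "\<dots> = (-1) ^ a * (of_int m * \<tau> + of_int n) ^ a"
        by (rule power_minus)
      finally show "(-1) ^ a * (qexp (- (of_int (- n) * of_real (1 - x))) / (of_int (- m) * \<tau> + of_int (- n)) ^ a) = 
         qexp (- (of_int n * of_real x)) / (of_int m * \<tau> + of_int n) ^ a"
        unfolding q by simp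
    qed
    finally show "((\<lambda>n::int. qexp (- (of_int n * of_real x)) / (of_int m * \<tau> + of_int n) ^ a) has_sum
            (C * (if m = 0 then - of_real (bernoulli_polynomial a x / real a)
               else if m > 0 then lerch (a - 1) (of_int m * \<tau>) x
               else (-1) ^ a * lerch (a - 1) (of_int (- m) * \<tau>) (1 - x)))) UNIV"
      using m by (simp add: mult_ac)
  qed
qed

definition lattice_row :: "nat \<Rightarrow> real \<Rightarrow> complex \<Rightarrow> int \<Rightarrow> complex" where
  "lattice_row a x \<tau> m = (\<Sum>\<^sub>\<infinity>n::int. qexp (- (of_int n * of_real x)) / (of_int m * \<tau> + of_int n) ^ a)"

lemma has_sum_lattice_row:
  assumes "a \<ge> 2" "0 \<le> x" "x \<le> 1" "Im \<tau> > 0"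
  shows "((\<lambda>n::int. qexp (- (of_int n * of_real x)) / (of_int m * \<tau> + of_int n) ^ a) has_sum
            lattice_row a x \<tau> m) UNIV"
  unfolding lattice_row_def
  by (intro has_sum_infsum has_sum_imp_summable[OF lattice_row_has_sum] assms)

text \<open>Rows with m > 0 give the series of F with \<alpha> and -\<beta>, rows with m < 0 the one
  with 1 - \<alpha> and \<beta>, and m = 0 the Bernoulli constant. The sum is iterated, rows first;
  nothing is asserted about the double series over all (m, n).\<close>

lemma F_char_lattice:
  assumes "a \<ge> 2" "0 < \<alpha>" "\<alpha> < 1" "Im \<tau> > 0"
  shows "((\<lambda>m::int. qexp (- (of_int m * of_real \<beta>)) * lattice_row a \<alpha> \<tau> m) has_sum
           - ((- 2 * of_real pi * \<i>) ^ a / fact (a - 1)) * F_char a \<alpha> \<beta> \<tau>) UNIV"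
proof -
  define C :: complex where "C = (- 2 * of_real pi * \<i>) ^ a / fact (a - 1)"
  define f where "f = (\<lambda>m::int. qexp (- (of_int m * of_real \<beta>)) * 
              (if m = 0 then - of_real (bernoulli_polynomial a \<alpha> / real a)
               else if m > 0 then lerch (a - 1) (of_int m * \<tau>) \<alpha>
               else (-1) ^ a * lerch (a - 1) (of_int (- m) * \<tau>) (1 - \<alpha>)))"
  have "(f has_sum (f 0 + (infsum (lerch_double (a - 1) \<alpha> (- \<beta>) \<tau>) UNIV +
                  (-1) ^ a * infsum (lerch_double (a - 1) (1 - \<alpha>) \<beta> \<tau>) UNIV))) UNIV"
  proof (rule has_sum_int)
    have "((\<lambda>n. qexp (of_nat (Suc n) * of_real (- \<beta>)) * lerch (a - 1) (of_nat (Suc n) * \<tau>) \<alpha>)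
            has_sum infsum (lerch_double (a - 1) \<alpha> (- \<beta>) \<tau>) UNIV) UNIV"
      by (intro lerch_double_rows assms)
    also have "(\<lambda>n. qexp (of_nat (Suc n) * of_real (- \<beta>)) * lerch (a - 1) (of_nat (Suc n) * \<tau>) \<alpha>) =
               (\<lambda>n. f (int (Suc n)))"
      by (simp add: f_def fun_eq_iff del: of_nat_Suc)
    finally show "((\<lambda>n. f (int (Suc n))) has_sum infsum (lerch_double (a - 1) \<alpha> (- \<beta>) \<tau>) UNIV) UNIV" .
    have "((\<lambda>n. (-1) ^ a * (qexp (of_nat (Suc n) * of_real \<beta>) * lerch (a - 1) (of_nat (Suc n) * \<tau>) (1 - \<alpha>)))
            has_sum (-1) ^ a * infsum (lerch_double (a - 1) (1 - \<alpha>) \<beta> \<tau>) UNIV) UNIV"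
      by (intro has_sum_cmult_right lerch_double_rows) (use assms in auto)
    also have "(\<lambda>n. (-1) ^ a * (qexp (of_nat (Suc n) * of_real \<beta>) * lerch (a - 1) (of_nat (Suc n) * \<tau>) (1 - \<alpha>))) =
               (\<lambda>n. f (- int (Suc n)))"
      by (simp add: f_def fun_eq_iff mult.left_commute del: of_nat_Suc)
    finally show "((\<lambda>n. f (- int (Suc n))) has_sum (-1) ^ a * infsum (lerch_double (a - 1) (1 - \<alpha>) \<beta> \<tau>) UNIV) UNIV" .
  qed
  also have "f 0 + (infsum (lerch_double (a - 1) \<alpha> (- \<beta>) \<tau>) UNIV +
                  (-1) ^ a * infsum (lerch_double (a - 1) (1 - \<alpha>) \<beta> \<tau>) UNIV) = - F_char a \<alpha> \<beta> \<tau>"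
    by (simp add: f_def F_char_eq_lerch_double)
  finally have "((\<lambda>m. C * f m) has_sum C * (- F_char a \<alpha> \<beta> \<tau>)) UNIV"
    by (rule has_sum_cmult_right)
  also have "(\<lambda>m. C * f m) = (\<lambda>m::int. qexp (- (of_int m * of_real \<beta>)) * lattice_row a \<alpha> \<tau> m)"
  proof
    fix m :: int
    have "lattice_row a \<alpha> \<tau> m = C *
              (if m = 0 then - of_real (bernoulli_polynomial a \<alpha> / real a)
               else if m > 0 then lerch (a - 1) (of_int m * \<tau>) \<alpha>
               else (-1) ^ a * lerch (a - 1) (of_int (- m) * \<tau>) (1 - \<alpha>))"
      unfolding lattice_row_def C_def
      by (intro infsumI lattice_row_has_sum) (use assms in auto)
    thus "C * f m = qexp (- (of_int m * of_real \<beta>)) * lattice_row a \<alpha> \<tau> m"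
      unfolding f_def by (simp only: mult.left_commute)
  qed
  finally show ?thesis by (simp add: C_def)
qed

section \<open>Summation by parts and the exchange of order\<close>

lemma norm_power_diff_le:
  fixes x y :: complex
  assumes "norm x \<le> \<epsilon>" "norm y \<le> \<epsilon>" "norm (x - y) \<le> \<epsilon> ^ 2" "a > 0"
  shows "norm (x ^ a - y ^ a) \<le> real a * \<epsilon> ^ (a + 1)"
proof -
  have \<epsilon>: "\<epsilon> \<ge> 0" using order.trans[OF norm_ge_zero assms(1)] .
  \<comment> \<open>The cofactor in x^a - y^a = (x - y) (...) has a terms of size at most
    \<epsilon>^(a-1); the quadratic bound on x - y gains one order over \<epsilon>^a.\<close>
  have "norm (\<Sum>i<a. y ^ (a - Suc i) * x ^ i) \<le> real (card {..<a}) * \<epsilon> ^ (a - 1)"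
  proof (rule sum_norm_bound)
    fix i assume i: "i \<in> {..<a}"
    have "norm (y ^ (a - Suc i) * x ^ i) \<le> \<epsilon> ^ (a - Suc i) * \<epsilon> ^ i"
      unfolding norm_mult norm_power using assms \<epsilon> by (intro mult_mono power_mono) auto
    also have "\<dots> = \<epsilon> ^ (a - 1)"
      using i by (simp flip: power_add)
    finally show "norm (y ^ (a - Suc i) * x ^ i) \<le> \<epsilon> ^ (a - 1)" .
  qed
  hence "norm (x - y) * norm (\<Sum>i<a. y ^ (a - Suc i) * x ^ i) \<le> \<epsilon> ^ 2 * (real a * \<epsilon> ^ (a - 1))"
    using assms \<epsilon> by (intro mult_mono) auto
  also have "\<epsilon> ^ 2 * (real a * \<epsilon> ^ (a - 1)) = real a * \<epsilon> ^ (2 + (a - 1))"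
    by (simp only: power_add mult.left_commute)
  also have "2 + (a - 1) = a + 1" using assms(4) by simp
  finally show ?thesis
    unfolding power_diff_sumr2[of x a y] norm_mult .
qed

lemma has_sum_diff:
  fixes f g :: "'a \<Rightarrow> 'b::real_normed_vector"
  assumes "(f has_sum A) S" "(g has_sum B) S"
  shows "((\<lambda>x. f x - g x) has_sum (A - B)) S"
  using has_sum_add[OF assms(1) has_sum_uminus[THEN iffD2], of g "- B"] assms(2) by simp

text \<open>For neighbours z and w = z - 1, the difference of reciprocals is minus their product,
  hence quadratically small. The summand thus decays like the power a + 1 \<ge> 3 of the distance to
  the origin, enough in a two-dimensional lattice.\<close>

lemma lattice_difference_summable:
  assumes "a \<ge> 2" "Im \<tau> > 0"
  shows "(\<lambda>(m::int, n::int). norm (1 / (of_int m * \<tau> + of_int n) ^ a - 1 / (of_int m * \<tau> + of_int (n - 1)) ^ a))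
           summable_on UNIV"
proof -
  define f where "f = (\<lambda>(m::int, n::int). norm (1 / (of_int m * \<tau> + of_int n) ^ a - 1 / (of_int m * \<tau> + of_int (n - 1)) ^ a))"
  \<comment> \<open>The 3 comes from 1 + |m| + |n| \<le> 2 + |m| + |n-1| \<le> 3(|m| + |n-1|), valid
    once (m, n-1) is nonzero.\<close>
  define K where "K = 3 * lattice_const \<tau>"
  have K: "K > 0" using lattice_const_ge_1[OF assms(2)] by (simp add: K_def)
  define g where "g = (\<lambda>k::int. (1 + \<bar>real_of_int k\<bar>) powr (- (3 / 2)))"
  have "g summable_on UNIV" unfolding g_def by (intro summable_on_int_powr) auto
  then obtain G where G: "(g has_sum G) UNIV" unfolding summable_on_def by blast
  have "(\<lambda>(m, n). g m * g n) summable_on (UNIV \<times> UNIV)"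
  proof (rule summable_on_SigmaI)
    show "((\<lambda>n. case (m, n) of (m, n) \<Rightarrow> g m * g n) has_sum g m * G) UNIV" for m
      using has_sum_cmult_right[OF G] by simp
    show "(\<lambda>m. g m * G) summable_on UNIV"
      by (intro summable_on_cmult_left has_sum_imp_summable[OF G])
  qed (auto simp: g_def)
  hence g2: "(\<lambda>p. real a * K ^ (a + 1) * (case p of (m, n) \<Rightarrow> g m * g n)) summable_on UNIV"
    by (intro summable_on_cmult_right) simp
  \<comment> \<open>The two pairs at which one of the denominators vanishes; being finitely many,
    they are put back at the end.\<close>
  define E :: "(int \<times> int) set" where "E = {(0, 0), (0, 1)}"
  have "f summable_on (UNIV - E)"
  proof (rule summable_on_comparison_test)
    show "(\<lambda>p. real a * K ^ (a + 1) * (case p of (m, n) \<Rightarrow> g m * g n)) summable_on (UNIV - E)"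
      by (rule summable_on_subset_banach[OF g2]) auto
    show "f p \<ge> 0" for p by (simp add: f_def split: prod.splits)
    fix p assume p: "p \<in> UNIV - E"
    obtain m n where mn: "p = (m, n)" by force
    define R where "R = 1 + \<bar>real_of_int m\<bar> + \<bar>real_of_int n\<bar>"
    have R: "R \<ge> 1" by (simp add: R_def)
    define z where "z = of_int m * \<tau> + of_int n"
    define w where "w = of_int m * \<tau> + of_int (n - 1)"
    have "m \<noteq> 0 \<or> n \<noteq> 0" "m \<noteq> 0 \<or> n \<noteq> 1" using p by (auto simp: mn E_def)
    hence "\<bar>m\<bar> + \<bar>n\<bar> \<ge> 1" "\<bar>m\<bar> + \<bar>n - 1\<bar> \<ge> 1" by linarith+
    moreover have "\<bar>n\<bar> \<le> \<bar>n - 1\<bar> + 1" by linarith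
    ultimately have "1 + \<bar>m\<bar> + \<bar>n\<bar> \<le> 3 * (\<bar>m\<bar> + \<bar>n\<bar>) \<and> 1 + \<bar>m\<bar> + \<bar>n\<bar> \<le> 3 * (\<bar>m\<bar> + \<bar>n - 1\<bar>)"
      by (auto simp: distrib_left)
    hence "real_of_int (1 + \<bar>m\<bar> + \<bar>n\<bar>) \<le> real_of_int (3 * (\<bar>m\<bar> + \<bar>n\<bar>))" 
          "real_of_int (1 + \<bar>m\<bar> + \<bar>n\<bar>) \<le> real_of_int (3 * (\<bar>m\<bar> + \<bar>n - 1\<bar>))"
      unfolding of_int_le_iff by blast+
    hence "R \<le> 3 * (\<bar>real_of_int m\<bar> + \<bar>real_of_int n\<bar>)" "R \<le> 3 * (\<bar>real_of_int m\<bar> + \<bar>real_of_int (n - 1)\<bar>)"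
      by (simp_all add: R_def)
    moreover have "3 * (\<bar>real_of_int m\<bar> + \<bar>real_of_int n\<bar>) \<le> K * norm z"
        "3 * (\<bar>real_of_int m\<bar> + \<bar>real_of_int (n - 1)\<bar>) \<le> K * norm w"
      using lattice_bound[OF assms(2), of m n] lattice_bound[OF assms(2), of m "n - 1"]
      unfolding K_def z_def w_def mult.assoc by (simp_all del: of_int_diff)
    ultimately have Rz: "R \<le> K * norm z" and Rw: "R \<le> K * norm w"
      by (blast intro: order.trans)+
    have nz: "z \<noteq> 0" "w \<noteq> 0" using Rz Rw R by auto
    have gen: "1 / b \<le> K / R" if "R \<le> K * b" "b > 0" for b
      using that R by (simp add: field_simps)
    have xz: "norm (1 / z) \<le> K / R" and xw: "norm (1 / w) \<le> K / R"
      unfolding norm_divide norm_one by (intro gen Rz Rw; simp add: nz)+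
    have "1 / z - 1 / w = (w - z) / (z * w)"
      using nz by (simp add: diff_frac_eq)
    also have "w - z = -1" by (simp add: z_def w_def)
    finally have "1 / z - 1 / w = - ((1 / z) * (1 / w))"
      by simp
    hence "norm (1 / z - 1 / w) = norm (1 / z) * norm (1 / w)"
      by (simp only: norm_minus_cancel norm_mult)
    also have "\<dots> \<le> (K / R) * (K / R)"
      using xz xw K R by (intro mult_mono) auto
    finally have "norm (1 / z - 1 / w) \<le> (K / R) ^ 2" by (simp add: power2_eq_square)
    with xz xw have "norm ((1 / z) ^ a - (1 / w) ^ a) \<le> real a * (K / R) ^ (a + 1)"
      by (rule norm_power_diff_le) (use assms in auto)
    also have "\<dots> = real a * K ^ (a + 1) * (1 / R ^ (a + 1))"
      by (simp add: power_divide)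
    finally have le: "f p \<le> real a * K ^ (a + 1) * (1 / R ^ (a + 1))"
      by (simp add: f_def mn z_def w_def power_divide)
    have "1 / R ^ (a + 1) \<le> 1 / R ^ 3"
      using R assms by (intro divide_left_mono power_increasing) auto
    also have "1 / R ^ 3 = R powr (- 3)"
      using R by (simp add: powr_minus powr_numeral inverse_eq_divide)
    \<comment> \<open>Splitting the exponent 3 evenly dominates the term by a product of
      one-variable series with exponent 3/2 > 1.\<close>
    also have "\<dots> = R powr (- (3 / 2)) * R powr (- (3 / 2))"
      by (simp flip: powr_add)
    also have "\<dots> \<le> g m * g n"
      unfolding g_def by (intro mult_mono powr_mono2') (auto simp: R_def)
    finally have "real a * K ^ (a + 1) * (1 / R ^ (a + 1)) \<le> real a * K ^ (a + 1) * (g m * g n)"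
      using K by (intro mult_left_mono) auto
    with le show "f p \<le> real a * K ^ (a + 1) * (case p of (m, n) \<Rightarrow> g m * g n)"
      by (simp add: mn)
  qed
  moreover have "f summable_on E" by (rule summable_on_finite) (simp add: E_def)
  ultimately have "f summable_on (UNIV - E) \<union> E" by (rule summable_on_Un_disjoint) auto
  thus ?thesis by (simp add: f_def)
qed

text \<open>The weighted differences \<open>D\<close> are absolutely summable with total T, so they
  may be summed in either order. Rows first they give (1-q) S, columns first (1-q) S', and q
  \<noteq> 1 because \<alpha> is not an integer.\<close>

lemma lattice_sum_swap:
  assumes a: "a \<ge> 2" and \<alpha>: "0 < \<alpha>" "\<alpha> < 1" and \<tau>: "Im \<tau> > 0"
    and g: "\<And>m::int. ((\<lambda>n::int. qexp (- (of_int n * of_real \<alpha>)) / (of_int m * \<tau> + of_int n) ^ a) has_sum g m) UNIV"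
    and h: "\<And>n::int. ((\<lambda>m::int. qexp (- (of_int m * of_real \<beta>)) / (of_int m * \<tau> + of_int n) ^ a) has_sum h n) UNIV"
    and S: "((\<lambda>m::int. qexp (- (of_int m * of_real \<beta>)) * g m) has_sum S) UNIV"
    and S': "((\<lambda>n::int. qexp (- (of_int n * of_real \<alpha>)) * h n) has_sum S') UNIV"
  shows "S = S'"
proof -
  define q where "q = qexp (- of_real \<alpha>)"
  have "q \<noteq> 1"
  proof
    assume "q = 1"
    hence "\<alpha> \<in> \<int>" using qexp_eq_1_iff[of "- \<alpha>"] by (simp add: q_def)
    thus False using \<alpha> by (auto elim!: Ints_cases)
  qed
  have q_shift: "qexp (- (of_int n * of_real \<alpha>)) = q * qexp (- (of_int (n - 1) * of_real \<alpha>))" for n :: int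
    unfolding q_def qexp_add [symmetric] by (simp add: algebra_simps)
  define D where "D = (\<lambda>(m::int, n::int). qexp (- (of_int m * of_real \<beta>)) * (qexp (- (of_int n * of_real \<alpha>)) *
     (1 / (of_int m * \<tau> + of_int n) ^ a - 1 / (of_int m * \<tau> + of_int (n - 1)) ^ a)))"
  have "(\<lambda>p. norm (D p)) summable_on UNIV"
    using lattice_difference_summable[OF a \<tau>] by (simp add: D_def norm_mult case_prod_unfold)
  hence "D summable_on UNIV" by (rule abs_summable_summable)
  then obtain T where T: "(D has_sum T) (UNIV \<times> UNIV)" by (auto simp: summable_on_def)
  have shift: "bij (\<lambda>n::int. n - 1)" by (rule bij_betwI[of _ _ _ "\<lambda>n. n + 1"]) auto

  \<comment> \<open>Rows first: the shift of n happens inside each row and multiplies the row sum by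
    q.\<close>
  have "((\<lambda>m. (1 - q) * (qexp (- (of_int m * of_real \<beta>)) * g m)) has_sum T) UNIV"
  proof (rule has_sum_SigmaD[OF T])
    fix m :: int
    have "((\<lambda>n::int. q * (qexp (- (of_int (n - 1) * of_real \<alpha>)) / (of_int m * \<tau> + of_int (n - 1)) ^ a)) has_sum q * g m) UNIV"
      by (intro has_sum_cmult_right) (subst has_sum_reindex_bij_betw[OF shift], rule g)
    hence "((\<lambda>n::int. qexp (- (of_int n * of_real \<alpha>)) / (of_int m * \<tau> + of_int (n - 1)) ^ a) has_sum q * g m) UNIV"
      by (simp only: times_divide_eq_right q_shift [symmetric])
    from has_sum_cmult_right[OF has_sum_diff[OF g[of m] this], of "qexp (- (of_int m * of_real \<beta>))"]
    have "((\<lambda>n. D (m, n)) has_sum qexp (- (of_int m * of_real \<beta>)) * (g m - q * g m)) UNIV"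
      by (simp add: D_def right_diff_distrib)
    thus "((\<lambda>n. D (m, n)) has_sum (1 - q) * (qexp (- (of_int m * of_real \<beta>)) * g m)) UNIV"
      by (simp add: algebra_simps)
  qed
  with has_sum_cmult_right[OF S] have 1: "(1 - q) * S = T" by (rule has_sum_unique)

  \<comment> \<open>Columns first: the difference now falls on the column sums \<open>h\<close>, and
    shifting the outer index n produces the factor 1 - q.\<close>
  have "((\<lambda>n. qexp (- (of_int n * of_real \<alpha>)) * (h n - h (n - 1))) has_sum T) UNIV"
  proof (rule has_sum_SigmaD)
    show "((\<lambda>(n, m). D (m, n)) has_sum T) (UNIV \<times> UNIV)"
      using T by (subst has_sum_swap) (simp add: case_prod_unfold)
    fix n :: int
    from has_sum_cmult_right[OF has_sum_diff[OF h[of n] h[of "n - 1"]], of "qexp (- (of_int n * of_real \<alpha>))"]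
    show "((\<lambda>m. case (n, m) of (n, m) \<Rightarrow> D (m, n)) has_sum qexp (- (of_int n * of_real \<alpha>)) * (h n - h (n - 1))) UNIV"
      unfolding D_def prod.case by (simp add: right_diff_distrib mult_ac)
  qed
  moreover have "((\<lambda>n. qexp (- (of_int n * of_real \<alpha>)) * (h n - h (n - 1))) has_sum (1 - q) * S') UNIV"
  proof -
    have "((\<lambda>n::int. q * (qexp (- (of_int (n - 1) * of_real \<alpha>)) * h (n - 1))) has_sum q * S') UNIV"
      by (intro has_sum_cmult_right) (subst has_sum_reindex_bij_betw[OF shift], rule S')
    hence "((\<lambda>n::int. qexp (- (of_int n * of_real \<alpha>)) * h (n - 1)) has_sum q * S') UNIV"
      by (simp only: mult.assoc [symmetric] q_shift [symmetric])
    from has_sum_diff[OF S' this] show ?thesis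
      by (simp only: right_diff_distrib left_diff_distrib mult_1)
  qed
  ultimately have "(1 - q) * S' = T" by (metis has_sum_unique)
  with 1 have "(1 - q) * S = (1 - q) * S'" by simp
  thus ?thesis using \<open>q \<noteq> 1\<close> by simp
qed

text \<open>With \<sigma> = -1/\<tau> one has m\<sigma> + n = (n\<tau> - m)/\<tau>, which accounts
  for \<tau>^a. Column n at \<sigma> becomes row n at \<tau> with inner index -m; e(-m\<beta>)
  equals the character of 1 - \<beta> at -m, while \<alpha> moves to the outer index.\<close>

lemma F_char_inversion:
  assumes "a \<ge> 2" "0 < \<alpha>" "\<alpha> < 1" "0 < \<beta>" "\<beta> < 1" "Im \<tau> > 0"
  shows "F_char a \<alpha> \<beta> (- 1 / \<tau>) = \<tau> ^ a * F_char a (1 - \<beta>) \<alpha> \<tau>"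
proof -
  define \<sigma> where "\<sigma> = - 1 / \<tau>"
  have \<tau>0: "\<tau> \<noteq> 0" using assms by auto
  have \<sigma>: "Im \<sigma> > 0"
    using assms(6) \<tau>0 by (simp add: \<sigma>_def Im_divide sum_power2_gt_zero_iff complex_eq_iff)
  define C :: complex where "C = (- 2 * of_real pi * \<i>) ^ a / fact (a - 1)"
  have C: "C \<noteq> 0" by (simp add: C_def)
  have "- C * F_char a \<alpha> \<beta> \<sigma> = \<tau> ^ a * (- C * F_char a (1 - \<beta>) \<alpha> \<tau>)"
  proof (rule lattice_sum_swap[OF assms(1-3) \<sigma>])
    show "((\<lambda>n::int. qexp (- (of_int n * of_real \<alpha>)) / (of_int m * \<sigma> + of_int n) ^ a) has_sum lattice_row a \<alpha> \<sigma> m) UNIV" for m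
      by (rule has_sum_lattice_row) (use assms \<sigma> in auto)
    show "((\<lambda>m::int. qexp (- (of_int m * of_real \<beta>)) * lattice_row a \<alpha> \<sigma> m) has_sum - C * F_char a \<alpha> \<beta> \<sigma>) UNIV"
      unfolding C_def by (intro F_char_lattice assms \<sigma>)
    have "((\<lambda>m::int. \<tau> ^ a * (qexp (- (of_int m * of_real \<alpha>)) * lattice_row a (1 - \<beta>) \<tau> m)) has_sum 
            \<tau> ^ a * (- C * F_char a (1 - \<beta>) \<alpha> \<tau>)) UNIV"
      unfolding C_def by (intro has_sum_cmult_right F_char_lattice) (use assms in auto)
    thus "((\<lambda>n::int. qexp (- (of_int n * of_real \<alpha>)) * (\<tau> ^ a * lattice_row a (1 - \<beta>) \<tau> n)) has_sum 
            \<tau> ^ a * (- C * F_char a (1 - \<beta>) \<alpha> \<tau>)) UNIV"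
      by (simp only: mult.left_commute)
    show "((\<lambda>m::int. qexp (- (of_int m * of_real \<beta>)) / (of_int m * \<sigma> + of_int n) ^ a) has_sum
            \<tau> ^ a * lattice_row a (1 - \<beta>) \<tau> n) UNIV" for n
    proof -
      have "((\<lambda>m::int. \<tau> ^ a * (qexp (- (of_int (-m) * of_real (1 - \<beta>))) / (of_int n * \<tau> + of_int (-m)) ^ a)) has_sum
              \<tau> ^ a * lattice_row a (1 - \<beta>) \<tau> n) UNIV"
        by (intro has_sum_cmult_right, subst has_sum_reindex_bij_betw[OF bij_uminus], rule has_sum_lattice_row)
           (use assms in auto)
      also have "(\<lambda>m::int. \<tau> ^ a * (qexp (- (of_int (-m) * of_real (1 - \<beta>))) / (of_int n * \<tau> + of_int (-m)) ^ a)) =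
                 (\<lambda>m::int. qexp (- (of_int m * of_real \<beta>)) / (of_int m * \<sigma> + of_int n) ^ a)"
      proof
        fix m :: int
        have "qexp (- (of_int (-m) * of_real (1 - \<beta>))) = qexp (of_int m + - (of_int m * of_real \<beta>))"
          by (simp add: algebra_simps)
        also have "\<dots> = qexp (- (of_int m * of_real \<beta>))" by (subst qexp_add) simp
        finally have q: "qexp (- (of_int (-m) * of_real (1 - \<beta>))) = qexp (- (of_int m * of_real \<beta>))" .
        have eq: "of_int m * \<sigma> + of_int n = (of_int n * \<tau> + of_int (-m)) / \<tau>"
          using \<tau>0 by (simp add: \<sigma>_def field_simps)
        show "\<tau> ^ a * (qexp (- (of_int (-m) * of_real (1 - \<beta>))) / (of_int n * \<tau> + of_int (-m)) ^ a) =
              qexp (- (of_int m * of_real \<beta>)) / (of_int m * \<sigma> + of_int n) ^ a"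
          unfolding q eq power_divide by simp
      qed
      finally show ?thesis .
    qed
  qed
  hence "C * F_char a \<alpha> \<beta> \<sigma> = C * (\<tau> ^ a * F_char a (1 - \<beta>) \<alpha> \<tau>)"
    by (simp add: mult_ac)
  thus ?thesis using C by (simp add: \<sigma>_def)
qed

text \<open>Periodicity of e makes 1 - \<beta> act as -\<beta>, so the substitution interchanges the
  two double series, with (-1)^a moving from one to the other. The constant term is the reflection
  of B_a.\<close>

lemma F_char_reflect:
  assumes "a \<ge> 2" "0 \<le> \<alpha>" "\<alpha> \<le> 1"
  shows "F_char a (1 - \<alpha>) (1 - \<beta>) \<tau> = (-1) ^ a * F_char a \<alpha> \<beta> \<tau>"
proof -
  have q: "qexp (of_nat (Suc m) * of_real (1 - \<beta>)) = qexp (of_nat (Suc m) * of_real (- \<beta>))"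
          "qexp (of_nat (Suc m) * of_real (- (1 - \<beta>))) = qexp (of_nat (Suc m) * of_real \<beta>)" for m
  proof -
    have "of_nat (Suc m) * of_real (1 - \<beta>) = (of_nat (Suc m) + of_nat (Suc m) * of_real (- \<beta>) :: complex)"
         "of_nat (Suc m) * of_real (- (1 - \<beta>)) = (- of_nat (Suc m) + of_nat (Suc m) * of_real \<beta> :: complex)"
      by (simp_all add: algebra_simps)
    thus "qexp (of_nat (Suc m) * of_real (1 - \<beta>)) = qexp (of_nat (Suc m) * of_real (- \<beta>))"
         "qexp (of_nat (Suc m) * of_real (- (1 - \<beta>))) = qexp (of_nat (Suc m) * of_real \<beta>)"
      by (simp_all only: qexp_add qexp_minus qexp_of_nat inverse_1 mult_1)
  qed
  have "(-1) ^ a * ((-1) ^ a * x) = (x :: complex)" for x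
    by (cases "even a") auto
  thus ?thesis
    unfolding F_char_eq_lerch_double lerch_double_def q
    using bernoulli_polynomial_reflect[OF assms] by (simp add: algebra_simps)
qed

text \<open>The new factor e(m(l + x)) equals e(mx) and merges into the character; x = \<alpha> and
  x = 1 - \<alpha> give the same change modulo 1. The argument is termwise, so \<beta> - \<alpha>
  may leave the unit interval.\<close>

lemma F_char_translate: "F_char a \<alpha> \<beta> (\<tau> + 1) = F_char a \<alpha> (\<beta> - \<alpha>) \<tau>"
proof -
  have q: "qexp (of_nat (Suc m) * of_real b) * qexp (of_real (real l + x) * (of_nat (Suc m) * (\<tau> + 1))) =
        qexp (of_nat (Suc m) * of_real (b + x)) * qexp (of_real (real l + x) * (of_nat (Suc m) * \<tau>))" for m l b x
  proof -
    have "of_nat (Suc m) * of_real b + of_real (real l + x) * (of_nat (Suc m) * (\<tau> + 1)) = 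
          of_nat (Suc m * l) + (of_nat (Suc m) * of_real (b + x) + of_real (real l + x) * (of_nat (Suc m) * \<tau>))"
      by (simp add: algebra_simps)
    thus ?thesis by (simp only: qexp_add [symmetric]) (simp only: qexp_add qexp_of_nat mult_1)
  qed
  have *: "lerch_double n x b (\<tau> + 1) = lerch_double n x (b + x) \<tau>" for n x b
  proof
    fix p :: "nat \<times> nat"
    obtain m l where p: "p = (m, l)" by force
    show "lerch_double n x b (\<tau> + 1) p = lerch_double n x (b + x) \<tau> p"
      unfolding p lerch_double_def prod.case
      by (subst (1 2) mult.left_commute) (simp only: q)
  qed
  have "qexp (of_nat (Suc m) * of_real (\<beta> + (1 - \<alpha>))) = qexp (of_nat (Suc m) * of_real (\<beta> - \<alpha>))" for m
  proof -
    have "of_nat (Suc m) * of_real (\<beta> + (1 - \<alpha>)) = (of_nat (Suc m) + of_nat (Suc m) * of_real (\<beta> - \<alpha>) :: complex)"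
      by (simp add: algebra_simps)
    thus ?thesis by (simp only: qexp_add qexp_of_nat mult_1)
  qed
  hence "lerch_double n x (\<beta> + (1 - \<alpha>)) \<tau> = lerch_double n x (\<beta> - \<alpha>) \<tau>" for n x
    unfolding lerch_double_def by simp
  thus ?thesis by (simp add: F_char_eq_lerch_double *)
qed

subsection \<open>The integral\<close>

text \<open>The product rule telescopes: differentiating the truncated exponential series lowers its
  length by one, and only the top term survives.\<close>

lemma Gamma_star_deriv:
  "((\<lambda>w. exp (- w) * (\<Sum>k<Suc n. w ^ k / fact k)) has_real_derivative - (w ^ n / fact n * exp (- w))) (at w)"
proof (induction n)
  case 0
  show ?case by (auto intro!: derivative_eq_intros)
next
  case (Suc n)
  have "((\<lambda>w::real. exp (- w) * (w ^ Suc n / fact (Suc n))) has_real_derivative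
           exp (- w) * (w ^ n / fact n) - w ^ Suc n / fact (Suc n) * exp (- w)) (at w)"
  proof -
    have 1: "((\<lambda>w::real. exp (- w)) has_real_derivative - exp (- w)) (at w)"
      by (auto intro!: derivative_eq_intros)
    have 2: "((\<lambda>w::real. w ^ Suc n / fact (Suc n)) has_real_derivative real (Suc n) * w ^ n / fact (Suc n)) (at w)"
      using DERIV_cdivide[OF DERIV_pow[of "Suc n" w], of "fact (Suc n)"]
      by (simp only: diff_Suc_Suc diff_zero)
    have "((\<lambda>w::real. exp (- w) * (w ^ Suc n / fact (Suc n))) has_real_derivative
           - exp (- w) * (w ^ Suc n / fact (Suc n)) + real (Suc n) * w ^ n / fact (Suc n) * exp (- w)) (at w)"
      by (rule DERIV_mult[OF 1 2])
    also have "real (Suc n) * w ^ n / fact (Suc n) = w ^ n / fact n"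
      by (simp del: of_nat_Suc)
    finally show ?thesis by (simp add: mult.commute)
  qed
  from DERIV_add[OF Suc this] show ?case
    by (simp only: sum.lessThan_Suc[of _ "Suc n"] distrib_left) (simp add: mult.commute)
qed

lemma Gamma_star_nonneg: "w \<ge> 0 \<Longrightarrow> Gamma_star (Suc n) w \<ge> 0"
  by (subst Gamma_star_eq) (simp_all add: sum_nonneg del: sum.lessThan_Suc)

text \<open>A quarter of the decay absorbs the powers of w. The remaining rate 3/4 must exceed 1/2,
  since with w = 4\<pi>yv the coefficients multiplied with it grow like exp(w/2).\<close>

lemma Gamma_star_le:
  assumes "w \<ge> 0"
  shows "Gamma_star (Suc n) w \<le> (\<Sum>k<Suc n. 4 ^ k) * exp (- (3 / 4 * w))"
proof -
  have "w ^ k / fact k \<le> 4 ^ k * exp (w / 4)" for k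
    using power_le_exp[of w "1 / 4" k] assms by (simp add: field_simps)
  hence "(\<Sum>k<Suc n. w ^ k / fact k) \<le> (\<Sum>k<Suc n. 4 ^ k * exp (w / 4))"
    by (rule sum_mono)
  hence "exp (- w) * (\<Sum>k<Suc n. w ^ k / fact k) \<le> exp (- w) * ((\<Sum>k<Suc n. 4 ^ k) * exp (w / 4))"
    unfolding sum_distrib_right by (rule mult_left_mono) simp
  also have "\<dots> = (\<Sum>k<Suc n. 4 ^ k) * exp (- w + w / 4)"
    by (simp only: exp_add mult_ac)
  also have "- w + w / 4 = - (3 / 4 * w)" by simp
  finally show ?thesis using assms by (subst Gamma_star_eq) auto
qed

text \<open>The closed form of \<open>Gamma_star\<close>, rescaled by b and shifted by s, is an
  antiderivative vanishing at infinity; the integrand is nonnegative on the half-line, so no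
  separate integrability argument is needed. It is used with b = 2\<pi>y and s = 2 Im
  \<tau>.\<close>

lemma has_bochner_integral_Gamma_star:
  assumes b: "b > 0" and s: "s \<ge> 0"
  shows "has_bochner_integral lborel (\<lambda>t. indicator {0..} t * ((s + t) ^ n * exp (- (b * (s + t)))))
           (fact n / b ^ Suc n * Gamma_star (Suc n) (b * s))"
proof (rule has_bochner_integral_nn_integral)
  define P where "P = (\<lambda>w::real. exp (- w) * (\<Sum>k<Suc n. w ^ k / fact k))"
  define F where "F = (\<lambda>t. - (fact n / b ^ Suc n) * P (b * (s + t)))"
  have "(\<integral>\<^sup>+t. ennreal ((s + t) ^ n * exp (- (b * (s + t)))) * indicator {0..} t \<partial>lborel) = ennreal (0 - F 0)"
  proof (rule nn_integral_FTC_atLeast)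
    show "DERIV F t :> (s + t) ^ n * exp (- (b * (s + t)))" for t
    proof -
      have "DERIV F t :> - (fact n / b ^ Suc n) * (- ((b * (s + t)) ^ n / fact n * exp (- (b * (s + t)))) * b)"
        unfolding F_def P_def
        by (intro DERIV_cmult DERIV_chain2[OF Gamma_star_deriv]) (auto intro!: derivative_eq_intros)
      thus ?thesis using b by (simp add: power_mult_distrib)
    qed
    have "((\<lambda>w::real. \<Sum>k<Suc n. (w ^ k / exp w) / fact k) \<longlongrightarrow> (\<Sum>k<Suc n. 0 / fact k)) at_top"
      by (rule tendsto_sum, rule tendsto_divide[OF tendsto_power_div_exp_0 tendsto_const]) simp
    also have "(\<lambda>w::real. \<Sum>k<Suc n. (w ^ k / exp w) / fact k) = P"
      unfolding P_def sum_distrib_left by (intro ext sum.cong refl) (simp add: exp_minus divide_inverse mult_ac)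
    finally have "(P \<longlongrightarrow> 0) at_top" by simp
    moreover have "filterlim (\<lambda>t. b * (s + t)) at_top at_top"
      by (rule filterlim_tendsto_pos_mult_at_top[OF tendsto_const b])
         (rule filterlim_tendsto_add_at_top[OF tendsto_const filterlim_ident])
    ultimately have "((\<lambda>t. P (b * (s + t))) \<longlongrightarrow> 0) at_top"
      by (rule filterlim_compose)
    from tendsto_mult_left[OF this, of "- (fact n / b ^ Suc n)"] show "(F \<longlongrightarrow> 0) at_top"
      by (simp add: F_def)
  qed (use s in auto)
  also have "0 - F 0 = fact n / b ^ Suc n * Gamma_star (Suc n) (b * s)"
    unfolding F_def P_def using b s by (subst Gamma_star_eq) auto
  also have "(\<lambda>t. ennreal ((s + t) ^ n * exp (- (b * (s + t)))) * indicator {0..} t) =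
      (\<lambda>t. ennreal (indicator {0..} t * ((s + t) ^ n * exp (- (b * (s + t))))))"
    by (auto simp: fun_eq_iff split: split_indicator)
  finally show "(\<integral>\<^sup>+t. ennreal (indicator {0..} t * ((s + t) ^ n * exp (- (b * (s + t))))) \<partial>lborel) =
      ennreal (fact n / b ^ Suc n * Gamma_star (Suc n) (b * s))" .
  show "fact n / b ^ Suc n * Gamma_star (Suc n) (b * s) \<ge> 0"
    using b s by (intro mult_nonneg_nonneg Gamma_star_nonneg divide_nonneg_nonneg) auto
qed (use s in \<open>auto simp: indicator_def\<close>)

text \<open>Interchange of sum and integral by absolute convergence: \<open>g\<close> is
  nonnegative, so the integral of the norm of a term is |c i| I i. Enumerating the pairs by
  \<open>prod_decode\<close> turns the unordered sums into ordinary series.\<close>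

lemma has_integral_infsum:
  fixes c :: "nat \<times> nat \<Rightarrow> complex" and g :: "nat \<times> nat \<Rightarrow> real \<Rightarrow> real"
  assumes g: "\<And>i. has_bochner_integral lborel (g i) (I i)" and nonneg: "\<And>i t. g i t \<ge> 0"
    and summI: "(\<lambda>i. norm (c i) * I i) summable_on UNIV"
    and summ: "\<And>t. (\<lambda>i. norm (c i * of_real (g i t))) summable_on UNIV"
  shows "((\<lambda>t. \<Sum>\<^sub>\<infinity>i. c i * of_real (g i t)) has_integral (\<Sum>\<^sub>\<infinity>i. c i * of_real (I i))) UNIV"
proof -
  have to_nat: "summable (\<lambda>k. norm (h (prod_decode k)))" "(\<Sum>k. h (prod_decode k)) = infsum h UNIV"
    if "(\<lambda>i. norm (h i)) summable_on UNIV" for h :: "nat \<times> nat \<Rightarrow> complex"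
  proof -
    show "summable (\<lambda>k. norm (h (prod_decode k)))"
      by (rule summable_on_imp_summable)
         (use that in \<open>simp add: summable_on_reindex_bij_betw[OF bij_prod_decode, of "\<lambda>i. norm (h i)"]\<close>)
    have "((\<lambda>k. h (prod_decode k)) has_sum infsum h UNIV) UNIV"
      unfolding has_sum_reindex_bij_betw[OF bij_prod_decode]
      by (rule has_sum_infsum[OF abs_summable_summable[OF that]])
    from has_sum_imp_sums[OF this] show "(\<Sum>k. h (prod_decode k)) = infsum h UNIV"
      by (rule sums_unique[symmetric])
  qed
  define f where "f = (\<lambda>i t. c i * complex_of_real (g i t))"
  have hbf: "has_bochner_integral lborel (f i) (c i * of_real (I i))" for i
    unfolding f_def by (intro has_bochner_integral_mult_right has_bochner_integral_of_real g)
  have int: "integrable lborel (f i)" "integral\<^sup>L lborel (f i) = c i * of_real (I i)" for i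
    using hbf[of i] by (simp_all add: has_bochner_integral_iff)
  have I_nonneg: "I i \<ge> 0" for i
  proof -
    have "I i = integral\<^sup>L lborel (g i)" using g[of i] by (simp add: has_bochner_integral_iff)
    also have "\<dots> \<ge> 0" using nonneg by (intro integral_nonneg_AE) auto
    finally show ?thesis .
  qed
  have norm_cI: "norm (c i * of_real (I i)) = norm (c i) * I i" for i
    using I_nonneg[of i] by (simp add: norm_mult)
  have norm_int: "integral\<^sup>L lborel (\<lambda>t. norm (f i t)) = norm (c i * of_real (I i))" for i
  proof -
    have "(\<lambda>t. norm (f i t)) = (\<lambda>t. norm (c i) * g i t)"
      using nonneg by (simp add: f_def norm_mult fun_eq_iff)
    thus ?thesis using g[of i] by (simp add: has_bochner_integral_iff norm_cI)
  qed
  have summI': "(\<lambda>i. norm (c i * of_real (I i))) summable_on UNIV"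
    using summI by (simp add: norm_cI)
  have summ': "(\<lambda>i. norm (f i t)) summable_on UNIV" for t
    using summ by (simp add: f_def)
  have 1: "AE t in lborel. summable (\<lambda>k. norm (f (prod_decode k) t))"
    using to_nat(1)[OF summ'] by simp
  have 2: "summable (\<lambda>k. integral\<^sup>L lborel (\<lambda>t. norm (f (prod_decode k) t)))"
    unfolding norm_int by (rule to_nat(1)[OF summI'])
  have "((\<lambda>t. \<Sum>k. f (prod_decode k) t) has_integral (\<Sum>k. integral\<^sup>L lborel (f (prod_decode k)))) UNIV"
    using has_integral_integral_lborel[OF integrable_suminf[OF int(1) 1 2]]
      integral_suminf[OF int(1) 1 2] by simp
  also have "(\<Sum>k. integral\<^sup>L lborel (f (prod_decode k))) = (\<Sum>\<^sub>\<infinity>i. c i * of_real (I i))"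
    unfolding int(2) by (rule to_nat(2)[OF summI'])
  also have "(\<lambda>t. \<Sum>k. f (prod_decode k) t) = (\<lambda>t. \<Sum>\<^sub>\<infinity>i. f i t)"
    by (rule ext) (rule to_nat(2)[OF summ'])
  finally show ?thesis by (simp add: f_def)
qed

section \<open>Termwise integration along the ray\<close>

definition E_double :: "nat \<Rightarrow> real \<Rightarrow> real \<Rightarrow> complex \<Rightarrow> nat \<times> nat \<Rightarrow> complex" where
  "E_double n x \<beta> \<tau> = (\<lambda>(m, l).
     of_real (Gamma_star (Suc n) (4 * pi * real (Suc m) * (real l + x) * Im \<tau>) / real (Suc m) ^ Suc n) *
     (qexp (of_nat (Suc m) * of_real \<beta>) * qexp (- (of_real (real l + x) * (of_nat (Suc m) * \<tau>)))))"

text \<open>On the ray, -cnj \<tau> + it = -\<tau> + i(2v + t), so the term with y = (m+1)(l+x) is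
  e(-y\<tau>) exp(-2\<pi>y(2v+t)) up to constants, and its integral is an incomplete Gamma value at
  4\<pi>yv. The power (l+x)^(n+1) cancels against y^(n+1), leaving (m+1)^(n+1) in the
  denominator.\<close>

lemma lerch_double_has_integral:
  assumes x: "x > 0" and \<tau>: "Im \<tau> > 0"
  shows "((\<lambda>t. of_real ((2 * Im \<tau> + t) ^ n) * infsum (lerch_double (Suc n) x \<beta> (- cnj \<tau> + \<i> * of_real t)) UNIV)
            has_integral (fact n / (2 * of_real pi) ^ Suc n * infsum (E_double n x \<beta> \<tau>) UNIV)) {0..}"
proof -
  define v where "v = Im \<tau>"
  have v: "v > 0" using \<tau> by (simp add: v_def)
  define y where "y = (\<lambda>(m, l). real (Suc m) * (real l + x))"
  have y: "y i > 0" for i using x by (auto simp: y_def split: prod.splits)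
  define c where "c = (\<lambda>(m, l). qexp (of_nat (Suc m) * of_real \<beta>) * (of_real (real l + x) ^ Suc n * 
                        qexp (- (of_real (real l + x) * (of_nat (Suc m) * \<tau>)))))"
  define g where "g = (\<lambda>i t. indicator {0..} t * ((2 * v + t) ^ n * exp (- (2 * pi * y i * (2 * v + t)))))"
  define I where "I = (\<lambda>i. fact n / (2 * pi * y i) ^ Suc n * Gamma_star (Suc n) (2 * pi * y i * (2 * v)))"
  have cg: "c i * of_real (g i t) = of_real ((2 * v + t) ^ n) * lerch_double (Suc n) x \<beta> (- cnj \<tau> + \<i> * of_real t) i"
    if "t \<ge> 0" for i t
  proof -
    obtain m l where i: "i = (m, l)" by force
    have cnj: "- cnj \<tau> = - \<tau> + 2 * \<i> * of_real v"
      by (simp add: complex_eq_iff v_def)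
    have "of_real (real l + x) * (of_nat (Suc m) * (- cnj \<tau> + \<i> * of_real t)) =
          - (of_real (real l + x) * (of_nat (Suc m) * \<tau>)) + \<i> * of_real (y i * (2 * v + t))"
      unfolding cnj by (simp add: i y_def algebra_simps)
    moreover have "qexp (\<i> * of_real (y i * (2 * v + t))) = of_real (exp (- (2 * pi * y i * (2 * v + t))))"
      unfolding qexp_def by (simp add: mult_ac flip: exp_of_real)
    ultimately have "qexp (of_real (real l + x) * (of_nat (Suc m) * (- cnj \<tau> + \<i> * of_real t))) =
        qexp (- (of_real (real l + x) * (of_nat (Suc m) * \<tau>))) * of_real (exp (- (2 * pi * y i * (2 * v + t))))"
      by (simp only: qexp_add)
    moreover have "g i t = (2 * v + t) ^ n * exp (- (2 * pi * y i * (2 * v + t)))"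
      using that by (simp add: g_def)
    ultimately show ?thesis
      unfolding c_def lerch_double_def i prod.case by (simp only: of_real_mult mult_ac)
  qed
  have "((\<lambda>t. \<Sum>\<^sub>\<infinity>i. c i * of_real (g i t)) has_integral (\<Sum>\<^sub>\<infinity>i. c i * of_real (I i))) UNIV"
  proof (rule has_integral_infsum)
    show "has_bochner_integral lborel (g i) (I i)" for i
      unfolding g_def I_def by (rule has_bochner_integral_Gamma_star) (use y[of i] v in auto)
    show "g i t \<ge> 0" for i t
      using v by (simp add: g_def indicator_def)
    show "(\<lambda>i. norm (c i * of_real (g i t))) summable_on UNIV" for t
    proof (cases "t \<ge> 0")
      case True
      have "(\<lambda>i. \<bar>(2 * v + t) ^ n\<bar> * norm (lerch_double (Suc n) x \<beta> (- cnj \<tau> + \<i> * of_real t) i)) summable_on UNIV"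
        using v True by (intro summable_on_cmult_right lerch_double_summable x) (simp add: v_def)
      thus ?thesis unfolding cg[OF True] norm_mult norm_of_real .
    qed (simp add: g_def)
    define L where "L = fact n * (\<Sum>k<Suc n. 4 ^ k :: real)"
    have L: "L \<ge> 0" unfolding L_def by (intro mult_nonneg_nonneg sum_nonneg) auto
    show "(\<lambda>i. norm (c i) * I i) summable_on UNIV"
    proof (rule summable_on_comparison_test)
      \<comment> \<open>The product of the growth exp(2\<pi>yv) and the Gamma bound exp(-3\<pi>yv)
        is exp(-\<pi>yv), exactly the modulus of an order-0 term at the point iv/2.\<close>
      show "(\<lambda>i. L * norm (lerch_double 0 x \<beta> (\<i> * of_real (v / 2)) i)) summable_on UNIV"
        using v by (intro summable_on_cmult_right lerch_double_summable x) simp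
      fix i :: "nat \<times> nat"
      obtain m l where i: "i = (m, l)" by force
      have norm_c: "norm (c i) = (real l + x) ^ Suc n * exp (2 * pi * y i * v)"
      proof -
        have "norm (qexp (of_nat (Suc m) * of_real \<beta>)) = 1"
          using norm_qexp_of_real[of "real (Suc m) * \<beta>"] by simp
        moreover have "norm (of_real (real l + x) ^ Suc n :: complex) = (real l + x) ^ Suc n"
          unfolding norm_power norm_of_real using x by simp
        moreover have "norm (qexp (- (of_real (real l + x) * (of_nat (Suc m) * \<tau>)))) = exp (2 * pi * y i * v)"
          unfolding norm_qexp by (simp add: i y_def v_def mult_ac del: of_nat_Suc)
        ultimately show ?thesis unfolding c_def i prod.case by (simp only: norm_mult mult_1)
      qed
      have norm_l: "norm (lerch_double 0 x \<beta> (\<i> * of_real (v / 2)) i) = exp (- (pi * y i * v))"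
      proof -
        have "norm (qexp (of_nat (Suc m) * of_real \<beta>)) = 1"
          using norm_qexp_of_real[of "real (Suc m) * \<beta>"] by simp
        moreover have "norm (qexp (of_real (real l + x) * (of_nat (Suc m) * (\<i> * of_real (v / 2))))) = exp (- (pi * y i * v))"
          unfolding norm_qexp by (simp add: i y_def mult_ac del: of_nat_Suc)
        ultimately show ?thesis unfolding lerch_double_def i prod.case by (simp only: norm_mult power_0 norm_one mult_1)
      qed
      have w: "2 * pi * y i * (2 * v) \<ge> 0" using y[of i] v by simp
      show "norm (c i) * I i \<ge> 0"
        using y[of i] unfolding I_def by (intro mult_nonneg_nonneg divide_nonneg_nonneg Gamma_star_nonneg w) auto
      have "(real l + x) ^ Suc n \<le> (2 * pi * y i) ^ Suc n"
      proof (rule power_mono)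
        have "1 * (real l + x) \<le> (2 * pi * real (Suc m)) * (real l + x)"
        proof (rule mult_right_mono)
          have "1 * 1 \<le> (2 * pi) * real (Suc m)"
            using pi_ge_two by (intro mult_mono) auto
          thus "1 \<le> 2 * pi * real (Suc m)" by simp
        qed (use x in auto)
        thus "real l + x \<le> 2 * pi * y i" by (simp add: i y_def mult.assoc)
      qed (use x in auto)
      hence le1: "(real l + x) ^ Suc n / (2 * pi * y i) ^ Suc n \<le> 1"
        using y[of i] by (subst divide_le_eq_1_pos) auto
      have "norm (c i) * I i = ((real l + x) ^ Suc n / (2 * pi * y i) ^ Suc n) *
              (fact n * (exp (2 * pi * y i * v) * Gamma_star (Suc n) (2 * pi * y i * (2 * v))))"
        unfolding norm_c I_def by (simp only: divide_inverse mult_ac)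
      also have "\<dots> \<le> 1 * (fact n * (exp (2 * pi * y i * v) * Gamma_star (Suc n) (2 * pi * y i * (2 * v))))"
        by (intro mult_right_mono le1 mult_nonneg_nonneg Gamma_star_nonneg w) auto
      also have "\<dots> \<le> 1 * (fact n * (exp (2 * pi * y i * v) * ((\<Sum>k<Suc n. 4 ^ k) * exp (- (3 / 4 * (2 * pi * y i * (2 * v)))))))"
        by (intro mult_left_mono Gamma_star_le w) auto
      also have "\<dots> = L * exp (2 * pi * y i * v + - (3 / 4 * (2 * pi * y i * (2 * v))))"
        by (simp only: exp_add L_def mult_ac mult_1)
      also have "2 * pi * y i * v + - (3 / 4 * (2 * pi * y i * (2 * v))) = - (pi * y i * v)"
        by (simp add: algebra_simps)
      finally show "norm (c i) * I i \<le> L * norm (lerch_double 0 x \<beta> (\<i> * of_real (v / 2)) i)"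
        unfolding norm_l .
    qed
  qed
  also have "(\<Sum>\<^sub>\<infinity>i. c i * of_real (I i)) = (\<Sum>\<^sub>\<infinity>i. fact n / (2 * of_real pi) ^ Suc n * E_double n x \<beta> \<tau> i)"
  proof (rule infsum_cong)
    fix i :: "nat \<times> nat"
    obtain m l where i: "i = (m, l)" by force
    have yi: "y i = real (Suc m) * (real l + x)" by (simp add: i y_def)
    have eq: "2 * pi * (real (Suc m) * (real l + x)) * (2 * v) = 4 * pi * real (Suc m) * (real l + x) * v"
      by simp
    have "(real l + x) ^ Suc n * I i = (real l + x) ^ Suc n * (fact n / (2 * pi * (real (Suc m) * (real l + x))) ^ Suc n *
             Gamma_star (Suc n) (4 * pi * real (Suc m) * (real l + x) * v))"
      unfolding I_def yi eq ..
    also have "\<dots> = fact n / (2 * pi) ^ Suc n * (Gamma_star (Suc n) (4 * pi * real (Suc m) * (real l + x) * v) / real (Suc m) ^ Suc n)"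
    proof -
      have "real l + x \<noteq> 0" using x by linarith
      hence nz: "(real l + x) ^ Suc n \<noteq> 0" by simp
      have gen: "X * (f / (p * (M * X)) * G) = f / p * (G / M)" if "X \<noteq> 0" for X f p M G :: real
        using that by simp
      show ?thesis unfolding power_mult_distrib[of "2 * pi"] power_mult_distrib[of "real (Suc m)"]
        by (rule gen[OF nz])
    qed
    finally have "complex_of_real ((real l + x) ^ Suc n * I i) = of_real (fact n / (2 * pi) ^ Suc n * 
        (Gamma_star (Suc n) (4 * pi * real (Suc m) * (real l + x) * v) / real (Suc m) ^ Suc n))"
      by (rule arg_cong)
    hence eq: "of_real (real l + x) ^ Suc n * complex_of_real (I i) = fact n / (2 * of_real pi) ^ Suc n * 
        of_real (Gamma_star (Suc n) (4 * pi * real (Suc m) * (real l + x) * v) / real (Suc m) ^ Suc n)"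
      by (simp only: of_real_mult of_real_divide of_real_power of_real_fact of_real_numeral)
    have "c i * of_real (I i) = (of_real (real l + x) ^ Suc n * complex_of_real (I i)) * 
        (qexp (of_nat (Suc m) * of_real \<beta>) * qexp (- (of_real (real l + x) * (of_nat (Suc m) * \<tau>))))"
      unfolding c_def i prod.case by (simp only: mult_ac)
    thus "c i * of_real (I i) = fact n / (2 * of_real pi) ^ Suc n * E_double n x \<beta> \<tau> i"
      unfolding eq unfolding E_double_def i prod.case v_def by (simp only: mult.assoc)
  qed
  also have "\<dots> = fact n / (2 * of_real pi) ^ Suc n * infsum (E_double n x \<beta> \<tau>) UNIV"
    by (rule infsum_cmult_right') 
  finally have "((\<lambda>t. if t \<in> {0..} then of_real ((2 * v + t) ^ n) * infsum (lerch_double (Suc n) x \<beta> (- cnj \<tau> + \<i> * of_real t)) UNIV else 0)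
            has_integral (fact n / (2 * of_real pi) ^ Suc n * infsum (E_double n x \<beta> \<tau>) UNIV)) UNIV"
  proof (rule has_integral_eq[rotated])
    fix t :: real
    show "(\<Sum>\<^sub>\<infinity>i. c i * of_real (g i t)) =
      (if t \<in> {0..} then of_real ((2 * v + t) ^ n) * infsum (lerch_double (Suc n) x \<beta> (- cnj \<tau> + \<i> * of_real t)) UNIV else 0)"
    proof (cases "t \<ge> 0")
      case True
      show ?thesis unfolding cg[OF True] using True by (simp add: infsum_cmult_right')
    qed (simp add: g_def)
  qed
  thus ?thesis unfolding has_integral_restrict_UNIV v_def .
qed

text \<open>For z = \<alpha>\<tau> + \<beta> both floors vanish, and m(z - l\<tau>) = m\<beta> - m(l
  - \<alpha>)\<tau> separates the character from the \<tau>-dependence. The sign (-1)^a is (-1)^n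
  because a = n + 2.\<close>

lemma E_minus_eq_E_double:
  assumes "0 < \<alpha>" "\<alpha> < 1" "Im \<tau> > 0"
  shows "E_minus (Suc (Suc n)) (of_real \<alpha> * \<tau> + of_real \<beta>) \<tau> =
           infsum (E_double n (1 - \<alpha>) \<beta> \<tau>) UNIV + (-1) ^ n * infsum (E_double n \<alpha> (- \<beta>) \<tau>) UNIV"
proof -
  define z where "z = of_real \<alpha> * \<tau> + of_real \<beta>"
  have y: "Im z / Im \<tau> = \<alpha>" using assms by (simp add: z_def)
  have fl: "\<lfloor>\<alpha>\<rfloor> = 0" using assms by (simp add: floor_eq_iff)
  have 1: "(\<Sum>\<^sub>\<infinity>(m, l)\<in>{1::nat..} \<times> {1 + 0::int..}.
        of_real (Gamma_star (Suc n) (4 * pi * real m * (real_of_int l - \<alpha>) * Im \<tau>)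
                   / real m ^ Suc n)
          * exp (2 * pi * \<i> * of_nat m * (z - of_int l * \<tau>))) = infsum (E_double n (1 - \<alpha>) \<beta> \<tau>) UNIV"
  proof (rule infsum_reindex_bij_witness[of _ "\<lambda>(m, l). (Suc m, int (Suc l))" "\<lambda>(m, l). (m - 1, nat l - 1)"])
    fix p :: "nat \<times> int" assume p: "p \<in> {1..} \<times> {1 + 0..}"
    define m l where "m = fst p - 1" and "l = nat (snd p) - 1"
    have p: "p = (Suc m, int (Suc l))" using p by (auto simp: m_def l_def prod_eq_iff)
    have l: "real_of_int (int (Suc l)) - \<alpha> = real l + (1 - \<alpha>)" by simp
    have "qexp (of_nat (Suc m) * of_real \<beta>) * qexp (- (of_real (real l + (1 - \<alpha>)) * (of_nat (Suc m) * \<tau>))) =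
          qexp (of_nat (Suc m) * (z - of_int (int (Suc l)) * \<tau>))"
      unfolding qexp_add [symmetric] z_def by (rule arg_cong[of _ _ qexp]) (simp add: algebra_simps)
    also have "\<dots> = exp (2 * pi * \<i> * of_nat (Suc m) * (z - of_int (int (Suc l)) * \<tau>))"
      unfolding qexp_def by (simp only: of_real_mult of_real_numeral mult.assoc)
    finally show "E_double n (1 - \<alpha>) \<beta> \<tau> ((\<lambda>(m, l). (m - 1, nat l - 1)) p) = (case p of (m, l) \<Rightarrow>
        of_real (Gamma_star (Suc n) (4 * pi * real m * (real_of_int l - \<alpha>) * Im \<tau>) / real m ^ Suc n)
          * exp (2 * pi * \<i> * of_nat m * (z - of_int l * \<tau>)))"
      unfolding p E_double_def prod.case l by (simp del: of_nat_Suc)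
  qed auto
  have 2: "(\<Sum>\<^sub>\<infinity>(m, l)\<in>{1::nat..} \<times> {- 0::int..}.
        of_real (Gamma_star (Suc n) (4 * pi * real m * (real_of_int l + \<alpha>) * Im \<tau>)
                   / real m ^ Suc n)
          * exp (- 2 * pi * \<i> * of_nat m * (z + of_int l * \<tau>))) = infsum (E_double n \<alpha> (- \<beta>) \<tau>) UNIV"
  proof (rule infsum_reindex_bij_witness[of _ "\<lambda>(m, l). (Suc m, int l)" "\<lambda>(m, l). (m - 1, nat l)"])
    fix p :: "nat \<times> int" assume p: "p \<in> {1..} \<times> {- 0..}"
    define m l where "m = fst p - 1" and "l = nat (snd p)"
    have p: "p = (Suc m, int l)" using p by (auto simp: m_def l_def prod_eq_iff)
    have l: "real_of_int (int l) + \<alpha> = real l + \<alpha>" by simp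
    have "qexp (of_nat (Suc m) * of_real (- \<beta>)) * qexp (- (of_real (real l + \<alpha>) * (of_nat (Suc m) * \<tau>))) =
          qexp (- (of_nat (Suc m) * (z + of_int (int l) * \<tau>)))"
      unfolding qexp_add [symmetric] z_def by (rule arg_cong[of _ _ qexp]) (simp add: algebra_simps)
    also have "\<dots> = exp (- 2 * pi * \<i> * of_nat (Suc m) * (z + of_int (int l) * \<tau>))"
      unfolding qexp_def by (simp del: of_nat_Suc add: mult.assoc)
    finally show "E_double n \<alpha> (- \<beta>) \<tau> ((\<lambda>(m, l). (m - 1, nat l)) p) = (case p of (m, l) \<Rightarrow>
        of_real (Gamma_star (Suc n) (4 * pi * real m * (real_of_int l + \<alpha>) * Im \<tau>) / real m ^ Suc n)
          * exp (- 2 * pi * \<i> * of_nat m * (z + of_int l * \<tau>)))"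
      unfolding p E_double_def prod.case l by (simp del: of_nat_Suc)
  qed auto
  show ?thesis
    unfolding E_minus_def Let_def z_def [symmetric] y fl diff_Suc_1 1 2 by simp
qed

theorem theorem1p2:
  fixes a :: nat and \<alpha> \<beta> :: real and \<tau> :: complex
  assumes "a \<ge> 2"
    and "0 < \<alpha>" "\<alpha> < 1"
    and "0 < \<beta>" "\<beta> < 1"
    and "Im \<tau> > 0"
  shows "integrable_to_i_infinity
           (\<lambda>w. (F_char a \<alpha> \<beta> w - of_real (bernoulli_polynomial a \<alpha> / real a))
                  / (- \<i> * (w + \<tau>)) powi (2 - int a))
           (- cnj \<tau>)
       \<and> E_minus a (of_real \<alpha> * \<tau> + of_real \<beta>) \<tau> =
           - ((- 2 * of_real pi) ^ (a - 1) * \<i> / fact (a - 2))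
           * integral_to_i_infinity
               (\<lambda>w. (F_char a \<alpha> \<beta> w - of_real (bernoulli_polynomial a \<alpha> / real a))
                      / (- \<i> * (w + \<tau>)) powi (2 - int a))
               (- cnj \<tau>)
       \<and> (\<forall>\<tau>'. Im \<tau>' > 0 \<longrightarrow>
             F_char a \<alpha> \<beta> (\<tau>' + 1) = F_char a \<alpha> (\<beta> - \<alpha>) \<tau>'
           \<and> F_char a \<alpha> \<beta> (- 1 / \<tau>') = \<tau>' ^ a * F_char a (1 - \<beta>) \<alpha> \<tau>'
           \<and> F_char a (1 - \<alpha>) (1 - \<beta>) \<tau>' = (-1) ^ a * F_char a \<alpha> \<beta> \<tau>')"
proof -
  define n where "n = a - 2"
  have a: "a = Suc (Suc n)" using assms(1) by (simp add: n_def)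
  define f where "f = (\<lambda>w. (F_char a \<alpha> \<beta> w - of_real (bernoulli_polynomial a \<alpha> / real a))
                      / (- \<i> * (w + \<tau>)) powi (2 - int a))"
  define D where "D = (\<lambda>x b t. infsum (lerch_double (Suc n) x b (- cnj \<tau> + \<i> * complex_of_real t)) UNIV)"
  define E1 where "E1 = infsum (E_double n (1 - \<alpha>) \<beta> \<tau>) UNIV"
  define E2 where "E2 = infsum (E_double n \<alpha> (- \<beta>) \<tau>) UNIV"
  define p where "p = (2 * of_real pi :: complex)"
  \<comment> \<open>The exponent 2 - a = -n turns the division into multiplication by (2v + t)^n,
    and subtracting the Bernoulli term leaves minus the two double series.\<close>
  have f: "f (- cnj \<tau> + \<i> * of_real t) * \<i> = - \<i> * ((-1) ^ n * (of_real ((2 * Im \<tau> + t) ^ n) * D (1 - \<alpha>) \<beta> t) +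
             of_real ((2 * Im \<tau> + t) ^ n) * D \<alpha> (- \<beta>) t)" if "t \<ge> 0" for t
  proof -
    have 1: "- \<i> * (- cnj \<tau> + \<i> * of_real t + \<tau>) = of_real (2 * Im \<tau> + t)"
      by (simp add: complex_eq_iff)
    have 2: "2 - int a = - int n" by (simp add: a)
    have 3: "F_char a \<alpha> \<beta> (- cnj \<tau> + \<i> * of_real t) - of_real (bernoulli_polynomial a \<alpha> / real a) =
                   - ((-1) ^ n * D (1 - \<alpha>) \<beta> t + D \<alpha> (- \<beta>) t)"
      unfolding F_char_eq_lerch_double D_def a diff_Suc_1 by simp
    show ?thesis
      unfolding f_def 1 2 3 power_int_minus power_int_of_nat by (simp add: divide_inverse algebra_simps)
  qed
  have "((\<lambda>t. - \<i> * ((-1) ^ n * (of_real ((2 * Im \<tau> + t) ^ n) * D (1 - \<alpha>) \<beta> t) +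
             of_real ((2 * Im \<tau> + t) ^ n) * D \<alpha> (- \<beta>) t)) has_integral
          - \<i> * ((-1) ^ n * (fact n / p ^ Suc n * E1) + fact n / p ^ Suc n * E2)) {0..}"
    unfolding D_def E1_def E2_def p_def
    by (intro has_integral_mult_right has_integral_add lerch_double_has_integral) (use assms in auto)
  hence int: "((\<lambda>t. f (- cnj \<tau> + \<i> * of_real t) * \<i>) has_integral
          - \<i> * ((-1) ^ n * (fact n / p ^ Suc n * E1) + fact n / p ^ Suc n * E2)) {0..}"
    by (rule has_integral_eq[rotated]) (simp only: f atLeast_iff)
  have "p \<noteq> 0" by (simp add: p_def)
  have "(- 2 * of_real pi :: complex) = - p" by (simp add: p_def)
  \<comment> \<open>This sign makes the total prefactor (-1)^n, which moves the alternating sign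
    from \<open>E1\<close> to \<open>E2\<close>, matching its position in
    \<open>E_minus\<close>.\<close>
  hence "(- 2 * of_real pi :: complex) ^ Suc n = - ((-1) ^ n * p ^ Suc n)"
    by (simp only: power_minus[of p "Suc n"]) simp
  hence "- ((- 2 * of_real pi) ^ (a - 1) * \<i> / fact (a - 2)) * integral_to_i_infinity f (- cnj \<tau>) =
    (((-1) ^ n * p ^ Suc n) * \<i> / fact n) * (- \<i> * ((-1) ^ n * (fact n / p ^ Suc n * E1) + fact n / p ^ Suc n * E2))"
    unfolding integral_to_i_infinity_def integral_unique[OF int] by (simp add: a del: power_Suc)
  also have "\<dots> = ((-1) ^ n * (-1) ^ n) * E1 + (-1) ^ n * E2"
    using \<open>p \<noteq> 0\<close> by (simp add: field_simps del: power_Suc)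
  also have "(-1) ^ n * (-1) ^ n = (1 :: complex)"
    by (simp flip: power_mult_distrib)
  also have "1 * E1 + (-1) ^ n * E2 = E_minus a (of_real \<alpha> * \<tau> + of_real \<beta>) \<tau>"
    unfolding a E1_def E2_def using assms by (subst E_minus_eq_E_double) auto
  finally have "E_minus a (of_real \<alpha> * \<tau> + of_real \<beta>) \<tau> =
      - ((- 2 * of_real pi) ^ (a - 1) * \<i> / fact (a - 2)) * integral_to_i_infinity f (- cnj \<tau>)" ..
  moreover have "integrable_to_i_infinity f (- cnj \<tau>)"
    unfolding integrable_to_i_infinity_def using int by blast
  ultimately show ?thesis
    unfolding f_def using F_char_translate F_char_inversion[OF assms(1-5)] F_char_reflect[of a \<alpha> \<beta>] assms
    by auto
qed

end
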